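(* Let $R$ be a division ring and let $Q=Q_1*_RQ_2$ be the amalgamated product of two quadratic extensions $Q_1$, $Q_2$ of $R$ with associated endomorphisms $\tau_1,\tau_2$ of $R$. If $\tau_1$ and $\tau_2$ are automorphisms, then every one-sided ideal (left or right) of $Q$ is either principal or doubly generated (i.e. generated, as a one-sided ideal of the corresponding side, by one or by two elements).
   Context: Rings are associative and unital. An extension of rings $R\subseteq A$ is quadratic if there is $x\in A\setminus R$ such that $A$ is a free left $R$-module with basis $\{1,x\}$; then there are a ring endomorphism $\tau$ of $R$, a left $\tau$-derivation $\delta$ of $R$ (a $\mathbb{Z}$-linear map with $\delta(rs)=\tau(r)\delta(s)+\delta(r)s$) and $a,b\in R$ with $xr=\tau(r)x+\delta(r)$ for all $r\in R$ and $x^2=ax+b$, and $A\cong R[x;\tau,\delta]/\langle x^2-ax-b\rangle$, where $R[x;\tau,\delta]$ is the Ore extension (free left $R$-module on $1,x,x^2,\dots$ with $xr=\tau(r)x+\delta(r)$). Fix such data $Q_1=R[x;\tau_1,\delta_1]/\langle x^2-ax-b\rangle$ and $Q_2=R[y;\tau_2,\delta_2]/\langle y^2-cy-d\rangle$ for the two quadratic extensions, with $a,b,c,d\in R$. The amalgamated product $Q_1*_RQ_2$ is the pushout, in the category of rings, of the inclusions $R\hookrightarrow Q_1$ and $R\hookrightarrow Q_2$. *)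

theory Defs
  imports "HOL-Algebra.Algebra"
begin

text \<open>
  Rings are unital and associative, not necessarily commutative; the members of \<^const>\<open>ring_hom\<close>
  preserve the unit.
\<close>

text \<open>Division rings; the name \<open>division_ring\<close> is taken by a type class.\<close>

locale skew_field = ring R for R (structure) +
  assumes one_not_zero: "\<one> \<noteq> \<zero>"
    and units_nonzero: "Units R = carrier R - {\<zero>}"


section \<open>One-sided ideals\<close>

locale left_ideal = ring R + additive_subgroup I R for I and R (structure) +
  assumes l_closed: "\<lbrakk>r \<in> carrier R; u \<in> I\<rbrakk> \<Longrightarrow> r \<otimes> u \<in> I"

locale right_ideal = ring R + additive_subgroup I R for I and R (structure) +
  assumes r_closed: "\<lbrakk>r \<in> carrier R; u \<in> I\<rbrakk> \<Longrightarrow> u \<otimes> r \<in> I"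

definition genlideal :: "('a, 'm) ring_scheme \<Rightarrow> 'a set \<Rightarrow> 'a set"
  where "genlideal R S = \<Inter>{I. left_ideal I R \<and> S \<subseteq> I}"

definition genrideal :: "('a, 'm) ring_scheme \<Rightarrow> 'a set \<Rightarrow> 'a set"
  where "genrideal R S = \<Inter>{I. right_ideal I R \<and> S \<subseteq> I}"


section \<open>Quadratic extensions\<close>

text \<open>
  A ring extension of \<open>R\<close> is given by an embedding \<open>i\<close> of \<open>R\<close> into \<open>A\<close> (an inclusion being the
  special case \<open>i = id\<close>). The last clause says that \<open>A\<close> is free on \<open>{1, x}\<close> as a left \<open>R\<close>-module.
\<close>

definition quadratic_extension ::
    "('r, 'm) ring_scheme \<Rightarrow> ('a, 'n) ring_scheme \<Rightarrow> ('r \<Rightarrow> 'a) \<Rightarrow> 'a \<Rightarrow> bool"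
  where "quadratic_extension R A i x \<longleftrightarrow>
    ring R \<and> ring A \<and> i \<in> ring_hom R A \<and> inj_on i (carrier R) \<and>
    x \<in> carrier A - i ` carrier R \<and>
    (\<forall>z \<in> carrier A. \<exists>!(r, s). r \<in> carrier R \<and> s \<in> carrier R \<and> z = i r \<oplus>\<^bsub>A\<^esub> i s \<otimes>\<^bsub>A\<^esub> x)"

definition left_derivation ::
    "('r, 'm) ring_scheme \<Rightarrow> ('r \<Rightarrow> 'r) \<Rightarrow> ('r \<Rightarrow> 'r) \<Rightarrow> bool"
  where "left_derivation R \<tau> \<delta> \<longleftrightarrow>
    \<delta> \<in> carrier R \<rightarrow> carrier R \<and>
    (\<forall>r \<in> carrier R. \<forall>s \<in> carrier R.
      \<delta> (r \<oplus>\<^bsub>R\<^esub> s) = \<delta> r \<oplus>\<^bsub>R\<^esub> \<delta> s \<and>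
      \<delta> (r \<otimes>\<^bsub>R\<^esub> s) = \<tau> r \<otimes>\<^bsub>R\<^esub> \<delta> s \<oplus>\<^bsub>R\<^esub> \<delta> r \<otimes>\<^bsub>R\<^esub> s)"

text \<open>
  \<open>\<tau>\<close>, \<open>\<delta>\<close>, \<open>a\<close>, \<open>b\<close> are the data associated with the quadratic extension and its generator \<open>x\<close>;
  they exist and are unique (\<open>\<tau>\<close> and \<open>\<delta>\<close> on \<open>carrier R\<close>), see \<open>quadratic_data_exists\<close> and
  \<open>quadratic_data_unique\<close> below.
\<close>

definition quadratic_data ::
    "('r, 'm) ring_scheme \<Rightarrow> ('a, 'n) ring_scheme \<Rightarrow> ('r \<Rightarrow> 'a) \<Rightarrow> 'a
      \<Rightarrow> ('r \<Rightarrow> 'r) \<Rightarrow> ('r \<Rightarrow> 'r) \<Rightarrow> 'r \<Rightarrow> 'r \<Rightarrow> bool"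
  where "quadratic_data R A i x \<tau> \<delta> a b \<longleftrightarrow>
    quadratic_extension R A i x \<and> \<tau> \<in> ring_hom R R \<and> left_derivation R \<tau> \<delta> \<and>
    a \<in> carrier R \<and> b \<in> carrier R \<and>
    (\<forall>r \<in> carrier R. x \<otimes>\<^bsub>A\<^esub> i r = i (\<tau> r) \<otimes>\<^bsub>A\<^esub> x \<oplus>\<^bsub>A\<^esub> i (\<delta> r)) \<and>
    x \<otimes>\<^bsub>A\<^esub> x = i a \<otimes>\<^bsub>A\<^esub> x \<oplus>\<^bsub>A\<^esub> i b"

lemma quadratic_extension_coord:
  assumes "quadratic_extension R A i x"
    and "r \<in> carrier R" "s \<in> carrier R" "r' \<in> carrier R" "s' \<in> carrier R"
    and "i s \<otimes>\<^bsub>A\<^esub> x \<oplus>\<^bsub>A\<^esub> i r = i s' \<otimes>\<^bsub>A\<^esub> x \<oplus>\<^bsub>A\<^esub> i r'"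
  shows "r = r' \<and> s = s'"
proof -
  interpret A: ring A using assms(1) by (simp add: quadratic_extension_def)
  have x: "x \<in> carrier A" and h: "i \<in> ring_hom R A"
    and ex: "\<forall>z \<in> carrier A. \<exists>!(r, s). r \<in> carrier R \<and> s \<in> carrier R \<and> z = i r \<oplus>\<^bsub>A\<^esub> i s \<otimes>\<^bsub>A\<^esub> x"
    using assms(1) by (auto simp: quadratic_extension_def)
  have i: "i t \<in> carrier A" if "t \<in> carrier R" for t using h that by (rule ring_hom_closed)
  have e: "i r \<oplus>\<^bsub>A\<^esub> i s \<otimes>\<^bsub>A\<^esub> x = i r' \<oplus>\<^bsub>A\<^esub> i s' \<otimes>\<^bsub>A\<^esub> x"
    using assms(2-6) i x A.a_comm by (metis A.m_closed)
  have "i r \<oplus>\<^bsub>A\<^esub> i s \<otimes>\<^bsub>A\<^esub> x \<in> carrier A" using assms i x by auto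
  then have "\<exists>!p. case p of (u, v) \<Rightarrow> u \<in> carrier R \<and> v \<in> carrier R \<and>
      i r \<oplus>\<^bsub>A\<^esub> i s \<otimes>\<^bsub>A\<^esub> x = i u \<oplus>\<^bsub>A\<^esub> i v \<otimes>\<^bsub>A\<^esub> x"
    using ex by blast
  moreover have "case (r, s) of (u, v) \<Rightarrow> u \<in> carrier R \<and> v \<in> carrier R \<and>
      i r \<oplus>\<^bsub>A\<^esub> i s \<otimes>\<^bsub>A\<^esub> x = i u \<oplus>\<^bsub>A\<^esub> i v \<otimes>\<^bsub>A\<^esub> x" using assms by auto
  moreover have "case (r', s') of (u, v) \<Rightarrow> u \<in> carrier R \<and> v \<in> carrier R \<and>
      i r \<oplus>\<^bsub>A\<^esub> i s \<otimes>\<^bsub>A\<^esub> x = i u \<oplus>\<^bsub>A\<^esub> i v \<otimes>\<^bsub>A\<^esub> x" using assms e by auto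
  ultimately have "(r, s) = (r', s')" by blast
  then show ?thesis by simp
qed

lemma quadratic_data_exists:
  assumes Q: "quadratic_extension R A i x"
  shows "\<exists>\<tau> \<delta> a b. quadratic_data R A i x \<tau> \<delta> a b"
proof -
  interpret R: ring R using Q by (simp add: quadratic_extension_def)
  interpret A: ring A using Q by (simp add: quadratic_extension_def)
  have x: "x \<in> carrier A" and h: "i \<in> ring_hom R A"
    and ex: "\<forall>z \<in> carrier A. \<exists>!(r, s). r \<in> carrier R \<and> s \<in> carrier R \<and> z = i r \<oplus>\<^bsub>A\<^esub> i s \<otimes>\<^bsub>A\<^esub> x"
    using Q by (auto simp: quadratic_extension_def)
  have i [simp]: "i t \<in> carrier A" if "t \<in> carrier R" for t using h that by (rule ring_hom_closed)
  note coord = quadratic_extension_coord[OF Q]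
  have dec: "\<exists>s r. s \<in> carrier R \<and> r \<in> carrier R \<and> z = i s \<otimes>\<^bsub>A\<^esub> x \<oplus>\<^bsub>A\<^esub> i r" if z: "z \<in> carrier A" for z
  proof -
    obtain r s where "r \<in> carrier R" "s \<in> carrier R" "z = i r \<oplus>\<^bsub>A\<^esub> i s \<otimes>\<^bsub>A\<^esub> x"
      using ex z by blast
    then show ?thesis using A.a_comm x by (metis A.m_closed i)
  qed
  have "\<forall>r \<in> carrier R. \<exists>s t. s \<in> carrier R \<and> t \<in> carrier R \<and> x \<otimes>\<^bsub>A\<^esub> i r = i s \<otimes>\<^bsub>A\<^esub> x \<oplus>\<^bsub>A\<^esub> i t"
    using dec x by simp
  then obtain \<tau> \<delta> where
    td: "\<And>r. r \<in> carrier R \<Longrightarrow> \<tau> r \<in> carrier R \<and> \<delta> r \<in> carrier R \<and>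
      x \<otimes>\<^bsub>A\<^esub> i r = i (\<tau> r) \<otimes>\<^bsub>A\<^esub> x \<oplus>\<^bsub>A\<^esub> i (\<delta> r)"
    by metis
  obtain a b where ab: "a \<in> carrier R" "b \<in> carrier R" "x \<otimes>\<^bsub>A\<^esub> x = i a \<otimes>\<^bsub>A\<^esub> x \<oplus>\<^bsub>A\<^esub> i b"
    using dec[of "x \<otimes>\<^bsub>A\<^esub> x"] x by auto
  have one: "\<tau> \<one>\<^bsub>R\<^esub> = \<one>\<^bsub>R\<^esub>"
  proof -
    have "i (\<tau> \<one>\<^bsub>R\<^esub>) \<otimes>\<^bsub>A\<^esub> x \<oplus>\<^bsub>A\<^esub> i (\<delta> \<one>\<^bsub>R\<^esub>) = i \<one>\<^bsub>R\<^esub> \<otimes>\<^bsub>A\<^esub> x \<oplus>\<^bsub>A\<^esub> i \<zero>\<^bsub>R\<^esub>"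
      using td[OF R.one_closed] ring_hom_one[OF h] ring_hom_zero[OF h] x R.ring_axioms A.ring_axioms
      by simp
    then show ?thesis using coord td by blast
  qed
  have add: "\<delta> (r \<oplus>\<^bsub>R\<^esub> s) = \<delta> r \<oplus>\<^bsub>R\<^esub> \<delta> s \<and> \<tau> (r \<oplus>\<^bsub>R\<^esub> s) = \<tau> r \<oplus>\<^bsub>R\<^esub> \<tau> s"
    if rs: "r \<in> carrier R" "s \<in> carrier R" for r s
  proof -
    have "i (\<tau> (r \<oplus>\<^bsub>R\<^esub> s)) \<otimes>\<^bsub>A\<^esub> x \<oplus>\<^bsub>A\<^esub> i (\<delta> (r \<oplus>\<^bsub>R\<^esub> s)) = x \<otimes>\<^bsub>A\<^esub> i r \<oplus>\<^bsub>A\<^esub> x \<otimes>\<^bsub>A\<^esub> i s"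
      using td[of "r \<oplus>\<^bsub>R\<^esub> s"] rs x by (simp add: ring_hom_add[OF h] A.r_distr)
    also have "\<dots> = i (\<tau> r \<oplus>\<^bsub>R\<^esub> \<tau> s) \<otimes>\<^bsub>A\<^esub> x \<oplus>\<^bsub>A\<^esub> i (\<delta> r \<oplus>\<^bsub>R\<^esub> \<delta> s)"
      using td[of r] td[of s] rs x by (simp add: ring_hom_add[OF h] A.l_distr A.a_ac)
    finally show ?thesis by (intro coord) (use td rs in auto)
  qed
  have mult: "\<delta> (r \<otimes>\<^bsub>R\<^esub> s) = \<tau> r \<otimes>\<^bsub>R\<^esub> \<delta> s \<oplus>\<^bsub>R\<^esub> \<delta> r \<otimes>\<^bsub>R\<^esub> s \<and> \<tau> (r \<otimes>\<^bsub>R\<^esub> s) = \<tau> r \<otimes>\<^bsub>R\<^esub> \<tau> s"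
    if rs: "r \<in> carrier R" "s \<in> carrier R" for r s
  proof -
    have "i (\<tau> (r \<otimes>\<^bsub>R\<^esub> s)) \<otimes>\<^bsub>A\<^esub> x \<oplus>\<^bsub>A\<^esub> i (\<delta> (r \<otimes>\<^bsub>R\<^esub> s)) = (x \<otimes>\<^bsub>A\<^esub> i r) \<otimes>\<^bsub>A\<^esub> i s"
      using td[of "r \<otimes>\<^bsub>R\<^esub> s"] rs x by (simp add: ring_hom_mult[OF h] A.m_assoc)
    also have "\<dots> = i (\<tau> r) \<otimes>\<^bsub>A\<^esub> (x \<otimes>\<^bsub>A\<^esub> i s) \<oplus>\<^bsub>A\<^esub> i (\<delta> r) \<otimes>\<^bsub>A\<^esub> i s"
      using td[of r] rs x by (simp add: A.l_distr A.m_assoc)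
    also have "\<dots> = i (\<tau> r \<otimes>\<^bsub>R\<^esub> \<tau> s) \<otimes>\<^bsub>A\<^esub> x \<oplus>\<^bsub>A\<^esub> i (\<tau> r \<otimes>\<^bsub>R\<^esub> \<delta> s \<oplus>\<^bsub>R\<^esub> \<delta> r \<otimes>\<^bsub>R\<^esub> s)"
      using td[of r] td[of s] rs x
      by (simp add: ring_hom_add[OF h] ring_hom_mult[OF h] A.r_distr A.m_assoc A.a_assoc)
    finally show ?thesis by (intro coord) (use td rs in auto)
  qed
  have "\<tau> \<in> ring_hom R R" using td one add mult by (intro ring_hom_memI) auto
  moreover have "left_derivation R \<tau> \<delta>" using td add mult by (auto simp: left_derivation_def)
  ultimately have "quadratic_data R A i x \<tau> \<delta> a b"
    using Q td ab by (auto simp: quadratic_data_def)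
  then show ?thesis by blast
qed

lemma quadratic_data_unique:
  assumes "quadratic_data R A i x \<tau> \<delta> a b" "quadratic_data R A i x \<tau>' \<delta>' a' b'"
  shows "\<forall>r \<in> carrier R. \<tau> r = \<tau>' r \<and> \<delta> r = \<delta>' r" "a = a'" "b = b'"
proof -
  have Q: "quadratic_extension R A i x" using assms by (simp add: quadratic_data_def)
  note coord = quadratic_extension_coord[OF Q]
  show "\<forall>r \<in> carrier R. \<tau> r = \<tau>' r \<and> \<delta> r = \<delta>' r"
  proof
    fix r assume r: "r \<in> carrier R"
    then have "i (\<tau> r) \<otimes>\<^bsub>A\<^esub> x \<oplus>\<^bsub>A\<^esub> i (\<delta> r) = i (\<tau>' r) \<otimes>\<^bsub>A\<^esub> x \<oplus>\<^bsub>A\<^esub> i (\<delta>' r)"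
      using assms by (simp add: quadratic_data_def)
    moreover have "\<tau> r \<in> carrier R" "\<tau>' r \<in> carrier R" "\<delta> r \<in> carrier R" "\<delta>' r \<in> carrier R"
      using assms r by (auto simp: quadratic_data_def left_derivation_def intro: ring_hom_closed)
    ultimately show "\<tau> r = \<tau>' r \<and> \<delta> r = \<delta>' r" using coord by blast
  qed
  have "i a \<otimes>\<^bsub>A\<^esub> x \<oplus>\<^bsub>A\<^esub> i b = i a' \<otimes>\<^bsub>A\<^esub> x \<oplus>\<^bsub>A\<^esub> i b'"
    using assms unfolding quadratic_data_def by simp
  then have "b = b' \<and> a = a'" using assms coord unfolding quadratic_data_def by blast
  then show "a = a'" "b = b'" by auto
qed


section \<open>The amalgamated product\<close>

text \<open>
  A pushout in the category of rings cannot be defined in HOL by quantifying over all test rings,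
  since these live on arbitrary types. It is therefore built as the ring with generators the
  elements of \<open>A\<close> and of \<open>B\<close>, and relations those holding in \<open>A\<close> and in \<open>B\<close> together with
  \<open>i r = k r\<close> for \<open>r\<close> in \<open>R\<close>: the carrier consists of ring expressions in these generators modulo
  the least congruence containing the ring axioms and the relations. The theorems
  \<open>amalgam_ring\<close>, \<open>amalgam_square\<close> and \<open>amalgam_universal\<close> below say that this ring is a pushout;
  in the last one the test ring ranges over all types.
\<close>

datatype ('a, 'b) rexp =
    GenL 'a | GenR 'b | Zero | One
  | Add "('a, 'b) rexp" "('a, 'b) rexp" | Neg "('a, 'b) rexp"
  | Mul "('a, 'b) rexp" "('a, 'b) rexp"

inductive_set rexps :: "('a, 'm) ring_scheme \<Rightarrow> ('b, 'n) ring_scheme \<Rightarrow> ('a, 'b) rexp set"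
  for A :: "('a, 'm) ring_scheme" and B :: "('b, 'n) ring_scheme"
  where
    GenL: "u \<in> carrier A \<Longrightarrow> GenL u \<in> rexps A B"
  | GenR: "v \<in> carrier B \<Longrightarrow> GenR v \<in> rexps A B"
  | Zero: "Zero \<in> rexps A B"
  | One: "One \<in> rexps A B"
  | Add: "\<lbrakk>p \<in> rexps A B; q \<in> rexps A B\<rbrakk> \<Longrightarrow> Add p q \<in> rexps A B"
  | Neg: "p \<in> rexps A B \<Longrightarrow> Neg p \<in> rexps A B"
  | Mul: "\<lbrakk>p \<in> rexps A B; q \<in> rexps A B\<rbrakk> \<Longrightarrow> Mul p q \<in> rexps A B"

inductive_set amalgam_rel ::
    "('r, 'l) ring_scheme \<Rightarrow> ('a, 'm) ring_scheme \<Rightarrow> ('b, 'n) ring_scheme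
      \<Rightarrow> ('r \<Rightarrow> 'a) \<Rightarrow> ('r \<Rightarrow> 'b) \<Rightarrow> (('a, 'b) rexp \<times> ('a, 'b) rexp) set"
  for R :: "('r, 'l) ring_scheme" and A :: "('a, 'm) ring_scheme" and B :: "('b, 'n) ring_scheme"
    and i :: "'r \<Rightarrow> 'a" and k :: "'r \<Rightarrow> 'b"
  where
    refl: "p \<in> rexps A B \<Longrightarrow> (p, p) \<in> amalgam_rel R A B i k"
  | sym: "(p, q) \<in> amalgam_rel R A B i k \<Longrightarrow> (q, p) \<in> amalgam_rel R A B i k"
  | trans: "\<lbrakk>(p, q) \<in> amalgam_rel R A B i k; (q, s) \<in> amalgam_rel R A B i k\<rbrakk>
      \<Longrightarrow> (p, s) \<in> amalgam_rel R A B i k"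
  | cong_add: "\<lbrakk>(p, p') \<in> amalgam_rel R A B i k; (q, q') \<in> amalgam_rel R A B i k\<rbrakk>
      \<Longrightarrow> (Add p q, Add p' q') \<in> amalgam_rel R A B i k"
  | cong_neg: "(p, p') \<in> amalgam_rel R A B i k \<Longrightarrow> (Neg p, Neg p') \<in> amalgam_rel R A B i k"
  | cong_mul: "\<lbrakk>(p, p') \<in> amalgam_rel R A B i k; (q, q') \<in> amalgam_rel R A B i k\<rbrakk>
      \<Longrightarrow> (Mul p q, Mul p' q') \<in> amalgam_rel R A B i k"
  | add_assoc: "\<lbrakk>p \<in> rexps A B; q \<in> rexps A B; s \<in> rexps A B\<rbrakk>
      \<Longrightarrow> (Add (Add p q) s, Add p (Add q s)) \<in> amalgam_rel R A B i k"
  | add_comm: "\<lbrakk>p \<in> rexps A B; q \<in> rexps A B\<rbrakk> \<Longrightarrow> (Add p q, Add q p) \<in> amalgam_rel R A B i k"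
  | add_zero: "p \<in> rexps A B \<Longrightarrow> (Add Zero p, p) \<in> amalgam_rel R A B i k"
  | add_neg: "p \<in> rexps A B \<Longrightarrow> (Add (Neg p) p, Zero) \<in> amalgam_rel R A B i k"
  | mul_assoc: "\<lbrakk>p \<in> rexps A B; q \<in> rexps A B; s \<in> rexps A B\<rbrakk>
      \<Longrightarrow> (Mul (Mul p q) s, Mul p (Mul q s)) \<in> amalgam_rel R A B i k"
  | one_mul: "p \<in> rexps A B \<Longrightarrow> (Mul One p, p) \<in> amalgam_rel R A B i k"
  | mul_one: "p \<in> rexps A B \<Longrightarrow> (Mul p One, p) \<in> amalgam_rel R A B i k"
  | distr_right: "\<lbrakk>p \<in> rexps A B; q \<in> rexps A B; s \<in> rexps A B\<rbrakk>
      \<Longrightarrow> (Mul (Add p q) s, Add (Mul p s) (Mul q s)) \<in> amalgam_rel R A B i k"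
  | distr_left: "\<lbrakk>p \<in> rexps A B; q \<in> rexps A B; s \<in> rexps A B\<rbrakk>
      \<Longrightarrow> (Mul s (Add p q), Add (Mul s p) (Mul s q)) \<in> amalgam_rel R A B i k"
  | genL_add: "\<lbrakk>u \<in> carrier A; u' \<in> carrier A\<rbrakk>
      \<Longrightarrow> (GenL (u \<oplus>\<^bsub>A\<^esub> u'), Add (GenL u) (GenL u')) \<in> amalgam_rel R A B i k"
  | genL_mul: "\<lbrakk>u \<in> carrier A; u' \<in> carrier A\<rbrakk>
      \<Longrightarrow> (GenL (u \<otimes>\<^bsub>A\<^esub> u'), Mul (GenL u) (GenL u')) \<in> amalgam_rel R A B i k"
  | genL_one: "(GenL \<one>\<^bsub>A\<^esub>, One) \<in> amalgam_rel R A B i k"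
  | genR_add: "\<lbrakk>v \<in> carrier B; v' \<in> carrier B\<rbrakk>
      \<Longrightarrow> (GenR (v \<oplus>\<^bsub>B\<^esub> v'), Add (GenR v) (GenR v')) \<in> amalgam_rel R A B i k"
  | genR_mul: "\<lbrakk>v \<in> carrier B; v' \<in> carrier B\<rbrakk>
      \<Longrightarrow> (GenR (v \<otimes>\<^bsub>B\<^esub> v'), Mul (GenR v) (GenR v')) \<in> amalgam_rel R A B i k"
  | genR_one: "(GenR \<one>\<^bsub>B\<^esub>, One) \<in> amalgam_rel R A B i k"
  | amalgamate: "r \<in> carrier R \<Longrightarrow> (GenL (i r), GenR (k r)) \<in> amalgam_rel R A B i k"

definition amalgam ::
    "('r, 'l) ring_scheme \<Rightarrow> ('a, 'm) ring_scheme \<Rightarrow> ('b, 'n) ring_scheme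
      \<Rightarrow> ('r \<Rightarrow> 'a) \<Rightarrow> ('r \<Rightarrow> 'b) \<Rightarrow> ('a, 'b) rexp set ring"
  where "amalgam R A B i k =
    (let E = amalgam_rel R A B i k in
     \<lparr> carrier = rexps A B // E,
       monoid.mult = (\<lambda>C D. \<Union>p \<in> C. \<Union>q \<in> D. E `` {Mul p q}),
       one = E `` {One},
       ring.zero = E `` {Zero},
       ring.add = (\<lambda>C D. \<Union>p \<in> C. \<Union>q \<in> D. E `` {Add p q}) \<rparr>)"

definition amalgam_inl ::
    "('r, 'l) ring_scheme \<Rightarrow> ('a, 'm) ring_scheme \<Rightarrow> ('b, 'n) ring_scheme
      \<Rightarrow> ('r \<Rightarrow> 'a) \<Rightarrow> ('r \<Rightarrow> 'b) \<Rightarrow> 'a \<Rightarrow> ('a, 'b) rexp set"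
  where "amalgam_inl R A B i k u = amalgam_rel R A B i k `` {GenL u}"

definition amalgam_inr ::
    "('r, 'l) ring_scheme \<Rightarrow> ('a, 'm) ring_scheme \<Rightarrow> ('b, 'n) ring_scheme
      \<Rightarrow> ('r \<Rightarrow> 'a) \<Rightarrow> ('r \<Rightarrow> 'b) \<Rightarrow> 'b \<Rightarrow> ('a, 'b) rexp set"
  where "amalgam_inr R A B i k v = amalgam_rel R A B i k `` {GenR v}"

primrec rexp_eval :: "('s, 'm) ring_scheme \<Rightarrow> ('a \<Rightarrow> 's) \<Rightarrow> ('b \<Rightarrow> 's) \<Rightarrow> ('a, 'b) rexp \<Rightarrow> 's"
  where
    "rexp_eval S f g (GenL u) = f u"
  | "rexp_eval S f g (GenR v) = g v"
  | "rexp_eval S f g Zero = \<zero>\<^bsub>S\<^esub>"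
  | "rexp_eval S f g One = \<one>\<^bsub>S\<^esub>"
  | "rexp_eval S f g (Add p q) = rexp_eval S f g p \<oplus>\<^bsub>S\<^esub> rexp_eval S f g q"
  | "rexp_eval S f g (Neg p) = \<ominus>\<^bsub>S\<^esub> rexp_eval S f g p"
  | "rexp_eval S f g (Mul p q) = rexp_eval S f g p \<otimes>\<^bsub>S\<^esub> rexp_eval S f g q"

locale ring_span = R: ring R + A: ring A + B: ring B
  for R :: "('r, 'l) ring_scheme" and A :: "('a, 'm) ring_scheme" and B :: "('b, 'n) ring_scheme" +
  fixes i :: "'r \<Rightarrow> 'a" and k :: "'r \<Rightarrow> 'b"
  assumes i_hom: "i \<in> ring_hom R A" and k_hom: "k \<in> ring_hom R B"
begin

abbreviation "T \<equiv> rexps A B"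
abbreviation "E \<equiv> amalgam_rel R A B i k"
abbreviation "P \<equiv> amalgam R A B i k"
abbreviation "inl \<equiv> amalgam_inl R A B i k"
abbreviation "inr \<equiv> amalgam_inr R A B i k"

lemma amalgam_rel_closed: "(p, q) \<in> E \<Longrightarrow> p \<in> T \<and> q \<in> T"
  by (induction rule: amalgam_rel.induct)
     (auto intro!: rexps.intros ring_hom_closed[OF i_hom] ring_hom_closed[OF k_hom])

lemma amalgam_rel_equiv: "equiv T E"
  by (rule equivI)
     (use amalgam_rel_closed in \<open>auto simp: refl_on_def sym_def trans_def
        intro: amalgam_rel.refl amalgam_rel.sym amalgam_rel.trans\<close>)

lemma amalgam_class_eq: "(p, q) \<in> E \<Longrightarrow> E `` {p} = E `` {q}"
  using amalgam_rel_equiv by (rule equiv_class_eq)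

lemma amalgam_carrierI: "p \<in> T \<Longrightarrow> E `` {p} \<in> carrier P"
  by (simp add: amalgam_def Let_def quotientI)

lemma amalgam_carrierE:
  assumes "C \<in> carrier P" obtains p where "p \<in> T" "C = E `` {p}"
  using assms by (auto simp: amalgam_def Let_def elim: quotientE)

lemma amalgam_add: "\<lbrakk>p \<in> T; q \<in> T\<rbrakk> \<Longrightarrow> E `` {p} \<oplus>\<^bsub>P\<^esub> E `` {q} = E `` {Add p q}"
  unfolding amalgam_def Let_def
  by (simp, rule UN_equiv_class2[OF amalgam_rel_equiv amalgam_rel_equiv])
     (auto simp: congruent2_def intro!: amalgam_class_eq amalgam_rel.cong_add)

lemma amalgam_mult: "\<lbrakk>p \<in> T; q \<in> T\<rbrakk> \<Longrightarrow> E `` {p} \<otimes>\<^bsub>P\<^esub> E `` {q} = E `` {Mul p q}"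
  unfolding amalgam_def Let_def
  by (simp, rule UN_equiv_class2[OF amalgam_rel_equiv amalgam_rel_equiv])
     (auto simp: congruent2_def intro!: amalgam_class_eq amalgam_rel.cong_mul)

lemma amalgam_zero: "\<zero>\<^bsub>P\<^esub> = E `` {Zero}"
  by (simp add: amalgam_def Let_def)

lemma amalgam_one: "\<one>\<^bsub>P\<^esub> = E `` {One}"
  by (simp add: amalgam_def Let_def)

lemmas amalgam_ops = amalgam_add amalgam_mult amalgam_zero amalgam_one

lemmas amalgam_laws =
  amalgam_rel.add_assoc[THEN amalgam_class_eq] amalgam_rel.add_zero[THEN amalgam_class_eq]
  amalgam_rel.add_neg[THEN amalgam_class_eq] amalgam_rel.mul_assoc[THEN amalgam_class_eq]
  amalgam_rel.one_mul[THEN amalgam_class_eq] amalgam_rel.mul_one[THEN amalgam_class_eq]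
  amalgam_rel.distr_left[THEN amalgam_class_eq] amalgam_rel.distr_right[THEN amalgam_class_eq]
  amalgam_rel.genL_add[THEN amalgam_class_eq] amalgam_rel.genL_mul[THEN amalgam_class_eq]
  amalgam_rel.genL_one[THEN amalgam_class_eq] amalgam_rel.genR_add[THEN amalgam_class_eq]
  amalgam_rel.genR_mul[THEN amalgam_class_eq] amalgam_rel.genR_one[THEN amalgam_class_eq]
  amalgam_rel.amalgamate[THEN amalgam_class_eq]

theorem amalgam_ring: "ring P"
proof (rule ringI)
  show "abelian_group P"
  proof (rule abelian_groupI)
    fix C assume "C \<in> carrier P"
    then obtain p where p: "p \<in> T" "C = E `` {p}" by (rule amalgam_carrierE)
    then have "E `` {Neg p} \<oplus>\<^bsub>P\<^esub> C = \<zero>\<^bsub>P\<^esub>"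
      by (simp add: amalgam_ops rexps.intros amalgam_laws)
    then show "\<exists>D \<in> carrier P. D \<oplus>\<^bsub>P\<^esub> C = \<zero>\<^bsub>P\<^esub>"
      using p by (blast intro: amalgam_carrierI rexps.Neg)
  next
    fix C D assume "C \<in> carrier P" "D \<in> carrier P"
    then show "C \<oplus>\<^bsub>P\<^esub> D = D \<oplus>\<^bsub>P\<^esub> C"
      by (elim amalgam_carrierE)
         (simp add: amalgam_ops amalgam_rel.add_comm[THEN amalgam_class_eq])
  qed ((elim amalgam_carrierE)?, simp add: amalgam_ops rexps.intros amalgam_laws amalgam_carrierI)+
  show "monoid P"
    by (rule monoidI; (elim amalgam_carrierE)?)
       (simp_all add: amalgam_ops rexps.intros amalgam_laws amalgam_carrierI)
qed (elim amalgam_carrierE, simp add: amalgam_ops rexps.intros amalgam_laws)+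

theorem amalgam_square:
  "inl \<in> ring_hom A P" "inr \<in> ring_hom B P" "\<And>r. r \<in> carrier R \<Longrightarrow> inl (i r) = inr (k r)"
proof -
  show "inl \<in> ring_hom A P"
    by (rule ring_hom_memI)
       (simp_all add: amalgam_inl_def amalgam_ops rexps.intros amalgam_laws amalgam_carrierI)
  show "inr \<in> ring_hom B P"
    by (rule ring_hom_memI)
       (simp_all add: amalgam_inr_def amalgam_ops rexps.intros amalgam_laws amalgam_carrierI)
  show "inl (i r) = inr (k r)" if "r \<in> carrier R" for r
    using that by (simp add: amalgam_inl_def amalgam_inr_def amalgam_laws)
qed

theorem amalgam_universal:
  fixes S :: "('s, 'k) ring_scheme"
  assumes S: "ring S" and f: "f \<in> ring_hom A S" and g: "g \<in> ring_hom B S"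
    and fg: "\<And>r. r \<in> carrier R \<Longrightarrow> f (i r) = g (k r)"
  obtains h where "h \<in> ring_hom P S"
    and "\<And>u. u \<in> carrier A \<Longrightarrow> h (inl u) = f u"
    and "\<And>v. v \<in> carrier B \<Longrightarrow> h (inr v) = g v"
    and "\<And>h' C. \<lbrakk>h' \<in> ring_hom P S; \<And>u. u \<in> carrier A \<Longrightarrow> h' (inl u) = f u;
           \<And>v. v \<in> carrier B \<Longrightarrow> h' (inr v) = g v; C \<in> carrier P\<rbrakk> \<Longrightarrow> h' C = h C"
proof -
  interpret S: ring S by (rule S)
  interpret P: ring P by (rule amalgam_ring)
  let ?e = "rexp_eval S f g"
  have closed: "?e p \<in> carrier S" if "p \<in> T" for p
    using that by induction (auto intro: ring_hom_closed[OF f] ring_hom_closed[OF g])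
  have resp: "?e p = ?e q" if "(p, q) \<in> E" for p q
    using that
    by (induction rule: amalgam_rel.induct)
       (auto simp: closed S.a_ac S.l_neg S.r_neg S.m_assoc S.l_distr S.r_distr fg
          ring_hom_add[OF f] ring_hom_mult[OF f] ring_hom_one[OF f]
          ring_hom_add[OF g] ring_hom_mult[OF g] ring_hom_one[OF g])
  define h where "h C = ?e (SOME p. p \<in> C)" for C
  have h: "h (E `` {p}) = ?e p" if "p \<in> T" for p
  proof -
    have "p \<in> E `` {p}" using that by (auto intro: amalgam_rel.refl)
    then have "(SOME q. q \<in> E `` {p}) \<in> E `` {p}" by (rule someI)
    then show ?thesis using resp by (auto simp: h_def)
  qed
  have hom: "h \<in> ring_hom P S"
    by (rule ring_hom_memI)
       (auto elim!: amalgam_carrierE simp: amalgam_ops h rexps.intros closed)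
  have uniq: "h' (E `` {p}) = ?e p"
    if h': "h' \<in> ring_hom P S" and L: "\<And>u. u \<in> carrier A \<Longrightarrow> h' (inl u) = f u"
      and R: "\<And>v. v \<in> carrier B \<Longrightarrow> h' (inr v) = g v" and "p \<in> T" for h' p
    using \<open>p \<in> T\<close>
  proof induction
    case (GenL u) then show ?case using L by (simp add: amalgam_inl_def)
  next
    case (GenR v) then show ?case using R by (simp add: amalgam_inr_def)
  next
    case Zero then show ?case
      using ring_hom_zero[OF h' amalgam_ring S] by (simp add: amalgam_zero)
  next
    case One then show ?case using ring_hom_one[OF h'] by (simp add: amalgam_one)
  next
    case (Add p q) then show ?case
      using ring_hom_add[OF h', of "E `` {p}" "E `` {q}"]
      by (simp add: amalgam_carrierI amalgam_add)
  next
    case (Neg p)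
    have "E `` {Neg p} \<oplus>\<^bsub>P\<^esub> E `` {p} = \<zero>\<^bsub>P\<^esub>"
      using Neg by (simp add: amalgam_ops rexps.intros amalgam_laws)
    then have "h' (E `` {Neg p}) \<oplus>\<^bsub>S\<^esub> h' (E `` {p}) = \<zero>\<^bsub>S\<^esub>"
      using ring_hom_add[OF h', of "E `` {Neg p}" "E `` {p}"] ring_hom_zero[OF h' amalgam_ring S] Neg
      by (simp add: amalgam_carrierI rexps.intros)
    then show ?case
      using Neg closed ring_hom_closed[OF h' amalgam_carrierI[OF rexps.Neg[OF Neg.hyps]]]
      by (simp add: S.minus_equality)
  next
    case (Mul p q) then show ?case
      using ring_hom_mult[OF h', of "E `` {p}" "E `` {q}"]
      by (simp add: amalgam_carrierI amalgam_mult)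
  qed
  show thesis
  proof (rule that[of h])
    show "h' C = h C"
      if "h' \<in> ring_hom P S" "\<And>u. u \<in> carrier A \<Longrightarrow> h' (inl u) = f u"
        "\<And>v. v \<in> carrier B \<Longrightarrow> h' (inr v) = g v" "C \<in> carrier P" for h' C
      using \<open>C \<in> carrier P\<close> by (rule amalgam_carrierE) (use that uniq h in auto)
  qed (auto simp: hom h amalgam_inl_def amalgam_inr_def rexps.intros)
qed

end

end

theory Submission
  imports Defs
begin

text \<open>
  Let \<open>Q\<close> be a ring generated by a division subring \<open>K\<close> and two elements \<open>x\<close>, \<open>y\<close>. For \<open>z = x\<close> and
  \<open>z = y\<close> let \<open>z\<^sup>2 \<in> K z + K\<close> and \<open>z k \<in> k' z + K\<close> for all \<open>k \<in> K\<close>, with \<open>k' \<in> K\<close> nonzero if \<open>k\<close> is.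
  As a left \<open>K\<close>-space, \<open>Q\<close> is spanned by the alternating words in \<open>x\<close> and \<open>y\<close>. In each positive
  length there are two of them, one ending in \<open>x\<close> and one ending in \<open>y\<close>, so that the leading
  coefficients in length \<open>n\<close> of the elements of a left ideal \<open>J\<close> form a subspace \<open>L\<^sub>n(J)\<close> of \<open>K\<^sup>2\<close>.
  The two words of the same length start with different letters. Each letter therefore extends one
  of them to the next alternating word, while it repeats the first letter of the other and, by the
  quadratic relation, does not raise its length. So if \<open>L\<^sub>n(J) \<noteq> 0\<close> then \<open>L\<^sub>m(J) \<noteq> 0\<close> for all
  \<open>m \<ge> n\<close>, and if \<open>L\<^sub>n(J) = K\<^sup>2\<close> then \<open>L\<^sub>m(J) = K\<^sup>2\<close> for all \<open>m \<ge> n\<close> (\<open>lead_Suc\<close>).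

  Two generators are enough because \<open>K\<^sup>2\<close> has no subspace strictly between a nonzero proper subspace
  and \<open>K\<^sup>2\<close>. If \<open>J\<close> meets \<open>K\<close> nontrivially, it contains \<open>1\<close>. Otherwise, and if \<open>J \<noteq> 0\<close>,
  take \<open>u \<in> J\<close> with a nonzero leading pair in the least possible length \<open>N\<close>. Either \<open>L\<^sub>n(Q u) = L\<^sub>n(J)\<close> for all \<open>n\<close>, whence
  \<open>J = Q u\<close> by induction on the length (\<open>left_ideal_subset_by_lead\<close>), or there is a least \<open>M\<close> with
  \<open>L\<^sub>M(Q u) \<noteq> L\<^sub>M(J)\<close>. Then \<open>M \<ge> N\<close>, so \<open>L\<^sub>M(Q u)\<close> is not zero, and any \<open>v \<in> J\<close> that shows the
  difference makes \<open>L\<^sub>M(Q u + Q v)\<close> all of \<open>K\<^sup>2\<close>; hence \<open>J = Q u + Q v\<close>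
  (\<open>left_ideal_two_generated\<close>).

  Here \<open>L\<^sub>n(J)\<close> collects the leading pairs of all expressions of elements of \<open>J\<close> by words of length
  at most \<open>n\<close>, so that the argument works from the fact that the words span \<open>Q\<close>. For the amalgamated
  product this holds because it is generated by the image \<open>K\<close> of \<open>R\<close> and the images of the two
  quadratic generators.

  Right ideals of \<open>Q\<close> are left ideals of the opposite ring. The rule \<open>x r = \<tau>(r) x + \<delta>(r)\<close> can be
  solved for \<open>\<tau>(r) x\<close>, and since \<open>\<tau>\<close> is surjective this gives \<open>K x \<subseteq> x K + K\<close>. So the opposite
  ring satisfies the same hypotheses.
\<close>


section \<open>The opposite ring\<close>

definition opposite :: "('a, 'm) ring_scheme \<Rightarrow> ('a, 'm) ring_scheme"
  where "opposite R = R\<lparr>monoid.mult := \<lambda>a b. b \<otimes>\<^bsub>R\<^esub> a\<rparr>"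

lemma opposite_sel [simp]:
  "carrier (opposite R) = carrier R"
  "a \<otimes>\<^bsub>opposite R\<^esub> b = b \<otimes>\<^bsub>R\<^esub> a"
  "\<one>\<^bsub>opposite R\<^esub> = \<one>\<^bsub>R\<^esub>"
  "\<zero>\<^bsub>opposite R\<^esub> = \<zero>\<^bsub>R\<^esub>"
  "ring.add (opposite R) = ring.add R"
  by (simp_all add: opposite_def)

lemma add_monoid_opposite [simp]: "add_monoid (opposite R) = add_monoid R"
  by (simp add: opposite_def)

lemma a_inv_opposite [simp]: "\<ominus>\<^bsub>opposite R\<^esub> a = \<ominus>\<^bsub>R\<^esub> a"
  by (simp add: a_inv_def)

lemma opposite_opposite [simp]: "opposite (opposite R) = R"
  by (simp add: opposite_def)

lemma ring_opposite:
  assumes "ring R" shows "ring (opposite R)"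
proof -
  interpret ring R by (rule assms)
  show ?thesis
  proof (rule ringI)
    show "abelian_group (opposite R)"
      using add.group_axioms add.comm_group_axioms
      by (intro abelian_group.intro abelian_monoid.intro abelian_group_axioms.intro)
         (simp_all add: comm_group_def)
    show "monoid (opposite R)" by (rule monoidI) (simp_all add: m_assoc)
  qed (simp_all add: l_distr r_distr)
qed

lemma ring_opposite_iff [simp]: "ring (opposite R) \<longleftrightarrow> ring R"
  using ring_opposite[of R] ring_opposite[of "opposite R"] by auto

lemma left_ideal_opposite: "left_ideal J (opposite R) \<longleftrightarrow> right_ideal J R"
  by (auto simp: left_ideal_def right_ideal_def left_ideal_axioms_def right_ideal_axioms_def
      additive_subgroup_def)

lemma genlideal_opposite: "genlideal (opposite R) S = genrideal R S"
  by (simp add: genlideal_def genrideal_def left_ideal_opposite)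

lemma generate_ring_opposite: "generate_ring (opposite R) H = generate_ring R H"
proof -
  have sub: "u \<in> generate_ring S H"
    if "u \<in> generate_ring (opposite S) H" for u and S :: "('a, 'b) ring_scheme"
    using that
    by induction (auto intro: generate_ring.intros)
  show ?thesis using sub[of _ R] sub[of _ "opposite R"] by auto
qed


section \<open>Generated left ideals\<close>

lemma (in ring) genlideal_left_ideal:
  assumes "S \<subseteq> carrier R" shows "left_ideal (genlideal R S) R"
proof -
  have R: "left_ideal (carrier R) R"
    by (intro left_ideal.intro left_ideal_axioms.intro additive_subgroup.intro ring_axioms
        add.subgroup_self) auto
  let ?F = "{I. left_ideal I R \<and> S \<subseteq> I}"
  have ne: "?F \<noteq> {}" using R assms by auto
  have "subgroup (\<Inter>?F) (add_monoid R)"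
    by (rule add.subgroups_Inter[OF _ ne]) (auto simp: left_ideal_def additive_subgroup_def)
  then show ?thesis
    unfolding genlideal_def
    by (intro left_ideal.intro left_ideal_axioms.intro additive_subgroup.intro ring_axioms)
       (auto intro: left_ideal.l_closed)
qed

lemma genlideal_incl: "S \<subseteq> genlideal R S"
  by (auto simp: genlideal_def)

lemma genlideal_least: "\<lbrakk>left_ideal J R; S \<subseteq> J\<rbrakk> \<Longrightarrow> genlideal R S \<subseteq> J"
  by (auto simp: genlideal_def)


section \<open>Alternating words and leading coefficients\<close>

text \<open>
  What the argument needs from a quadratic generator. The last clause about \<open>k\<close> says that the
  twist \<open>k \<mapsto> k'\<close> has trivial kernel; it keeps leading coefficients nonzero.
\<close>

definition quadratic_over :: "('a, 'm) ring_scheme \<Rightarrow> 'a set \<Rightarrow> 'a \<Rightarrow> bool"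
  where "quadratic_over Q K z \<longleftrightarrow> z \<in> carrier Q \<and>
    (\<forall>k \<in> K. \<exists>k' \<in> K. \<exists>k'' \<in> K. z \<otimes>\<^bsub>Q\<^esub> k = k' \<otimes>\<^bsub>Q\<^esub> z \<oplus>\<^bsub>Q\<^esub> k'' \<and> (k \<noteq> \<zero>\<^bsub>Q\<^esub> \<longrightarrow> k' \<noteq> \<zero>\<^bsub>Q\<^esub>)) \<and>
    (\<exists>a \<in> K. \<exists>b \<in> K. z \<otimes>\<^bsub>Q\<^esub> z = a \<otimes>\<^bsub>Q\<^esub> z \<oplus>\<^bsub>Q\<^esub> b)"

text \<open>
  The recursion adds letters in front, so the last letter is always \<open>z\<close> and the word of length
  \<open>n\<close> starts with \<open>z\<close> if and only if \<open>n\<close> is odd.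
\<close>

primrec alt_word :: "('a, 'm) ring_scheme \<Rightarrow> 'a \<Rightarrow> 'a \<Rightarrow> nat \<Rightarrow> 'a"
  where
    "alt_word Q z w 0 = \<one>\<^bsub>Q\<^esub>"
  | "alt_word Q z w (Suc n) = (if even n then z else w) \<otimes>\<^bsub>Q\<^esub> alt_word Q z w n"

locale two_quadratic_generators = ring Q for Q (structure) +
  fixes K and x y
  assumes K_subring: "subring K Q"
    and K_inv: "k \<in> K \<Longrightarrow> k \<noteq> \<zero> \<Longrightarrow> \<exists>k' \<in> K. k' \<otimes> k = \<one>"
    and x_quadratic: "quadratic_over Q K x" and y_quadratic: "quadratic_over Q K y"
    and generated: "carrier Q \<subseteq> generate_ring Q (K \<union> {x, y})"
begin

abbreviation "xword \<equiv> alt_word Q x y"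
abbreviation "yword \<equiv> alt_word Q y x"

lemma K_carrier [simp]: "k \<in> K \<Longrightarrow> k \<in> carrier Q"
  using subringE(1)[OF K_subring] by auto

lemma K_closed [simp]:
  "\<zero> \<in> K" "\<one> \<in> K" "k \<in> K \<Longrightarrow> \<ominus> k \<in> K"
  "k \<in> K \<Longrightarrow> l \<in> K \<Longrightarrow> k \<oplus> l \<in> K" "k \<in> K \<Longrightarrow> l \<in> K \<Longrightarrow> k \<otimes> l \<in> K"
  using subringE[OF K_subring] by auto

lemma letter_quadratic: "z \<in> {x, y} \<Longrightarrow> quadratic_over Q K z"
  using x_quadratic y_quadratic by auto

lemma letter_carrier: "z \<in> {x, y} \<Longrightarrow> z \<in> carrier Q"
  using letter_quadratic by (auto simp: quadratic_over_def)

lemma xy_carrier [simp]: "x \<in> carrier Q" "y \<in> carrier Q"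
  using letter_carrier by auto

lemma letter_commute:
  assumes "z \<in> {x, y}" "k \<in> K"
  obtains k' k'' where "k' \<in> K" "k'' \<in> K" "z \<otimes> k = k' \<otimes> z \<oplus> k''" "k \<noteq> \<zero> \<Longrightarrow> k' \<noteq> \<zero>"
  using letter_quadratic[OF assms(1)] assms(2) unfolding quadratic_over_def by blast

lemma letter_square:
  assumes "z \<in> {x, y}"
  obtains a b where "a \<in> K" "b \<in> K" "z \<otimes> z = a \<otimes> z \<oplus> b"
  using letter_quadratic[OF assms] unfolding quadratic_over_def by blast

lemma alt_word_carrier [simp]: "xword n \<in> carrier Q" "yword n \<in> carrier Q"
  by (induction n) auto

text \<open>The left \<open>K\<close>-span of the alternating words of length at most \<open>n\<close>.\<close>

primrec filt :: "nat \<Rightarrow> 'a set"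
  where
    "filt 0 = K"
  | "filt (Suc n) = {k \<otimes> xword (Suc n) \<oplus> l \<otimes> yword (Suc n) \<oplus> w | k l w. k \<in> K \<and> l \<in> K \<and> w \<in> filt n}"

declare filt.simps(2) [simp del] alt_word.simps(2) [simp del]

lemma filt_SucI:
  "\<lbrakk>k \<in> K; l \<in> K; w \<in> filt n\<rbrakk> \<Longrightarrow> k \<otimes> xword (Suc n) \<oplus> l \<otimes> yword (Suc n) \<oplus> w \<in> filt (Suc n)"
  by (auto simp: filt.simps(2))

lemma filt_SucE:
  assumes "v \<in> filt (Suc n)"
  obtains k l w where "k \<in> K" "l \<in> K" "w \<in> filt n" "v = k \<otimes> xword (Suc n) \<oplus> l \<otimes> yword (Suc n) \<oplus> w"
  using assms by (auto simp: filt.simps(2))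

lemma filt_carrier: "v \<in> filt n \<Longrightarrow> v \<in> carrier Q"
  by (induction n arbitrary: v) (auto elim!: filt_SucE)

lemma filt_add: "v \<in> filt n \<Longrightarrow> w \<in> filt n \<Longrightarrow> v \<oplus> w \<in> filt n"
proof (induction n arbitrary: v w)
  case (Suc n)
  obtain k l v' where v: "k \<in> K" "l \<in> K" "v' \<in> filt n" "v = k \<otimes> xword (Suc n) \<oplus> l \<otimes> yword (Suc n) \<oplus> v'"
    using Suc.prems(1) by (rule filt_SucE)
  obtain k2 l2 w' where w: "k2 \<in> K" "l2 \<in> K" "w' \<in> filt n"
      "w = k2 \<otimes> xword (Suc n) \<oplus> l2 \<otimes> yword (Suc n) \<oplus> w'"
    using Suc.prems(2) by (rule filt_SucE)
  have "v \<oplus> w = (k \<oplus> k2) \<otimes> xword (Suc n) \<oplus> (l \<oplus> l2) \<otimes> yword (Suc n) \<oplus> (v' \<oplus> w')"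
    using v w by (simp add: filt_carrier l_distr a_ac)
  then show ?case using v w Suc.IH by (auto intro: filt_SucI)
qed auto

lemma filt_smult: "k \<in> K \<Longrightarrow> v \<in> filt n \<Longrightarrow> k \<otimes> v \<in> filt n"
proof (induction n arbitrary: v)
  case (Suc n)
  obtain l m v' where v: "l \<in> K" "m \<in> K" "v' \<in> filt n" "v = l \<otimes> xword (Suc n) \<oplus> m \<otimes> yword (Suc n) \<oplus> v'"
    using Suc.prems(2) by (rule filt_SucE)
  have "k \<otimes> v = (k \<otimes> l) \<otimes> xword (Suc n) \<oplus> (k \<otimes> m) \<otimes> yword (Suc n) \<oplus> (k \<otimes> v')"
    using v Suc.prems by (simp add: filt_carrier r_distr m_assoc)
  then show ?case using v Suc by (auto intro: filt_SucI)
qed auto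

lemma filt_zero: "\<zero> \<in> filt n"
proof (induction n)
  case (Suc n)
  then show ?case using filt_SucI[of \<zero> \<zero> \<zero> n] by simp
qed auto

lemma filt_neg:
  assumes "v \<in> filt n" shows "\<ominus> v \<in> filt n"
  using filt_smult[of "\<ominus> \<one>" v n] assms by (simp add: filt_carrier l_minus)

lemma filt_Suc: "v \<in> filt n \<Longrightarrow> v \<in> filt (Suc n)"
  using filt_SucI[of \<zero> \<zero> v n] by (simp add: filt_carrier)

lemma filt_mono: "n \<le> m \<Longrightarrow> v \<in> filt n \<Longrightarrow> v \<in> filt m"
  by (induction rule: dec_induct) (auto intro: filt_Suc)

lemma alt_word_filt: "xword n \<in> filt n" "yword n \<in> filt n"
proof -
  have "xword (Suc m) \<in> filt (Suc m)" "yword (Suc m) \<in> filt (Suc m)" for m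
    using filt_SucI[of \<one> \<zero> \<zero> m] filt_SucI[of \<zero> \<one> \<zero> m] filt_zero by auto
  then show "xword n \<in> filt n" "yword n \<in> filt n" by (cases n; auto)+
qed

text \<open>
  The square of a letter is a combination of the letter and \<open>\<one>\<close>, so repeating the first letter of
  a word does not raise the length.
\<close>

lemma letter_times_prefixed:
  assumes z: "z \<in> {x, y}" and v: "v \<in> filt n" and zv: "z \<otimes> v \<in> filt (Suc n)"
  shows "z \<otimes> (z \<otimes> v) \<in> filt (Suc n)"
proof -
  obtain a b where ab: "a \<in> K" "b \<in> K" "z \<otimes> z = a \<otimes> z \<oplus> b" using z by (rule letter_square)
  have "z \<otimes> (z \<otimes> v) = (z \<otimes> z) \<otimes> v"
    using letter_carrier[OF z] filt_carrier[OF v] by (simp add: m_assoc)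
  also have "\<dots> = a \<otimes> (z \<otimes> v) \<oplus> b \<otimes> v"
    using letter_carrier[OF z] filt_carrier[OF v] ab by (simp add: m_assoc l_distr)
  also have "\<dots> \<in> filt (Suc n)"
    by (rule filt_add[OF filt_smult[OF ab(1) zv] filt_smult[OF ab(2) filt_Suc[OF v]]])
  finally show ?thesis .
qed

text \<open>
  The words \<open>xword (Suc n)\<close> and \<open>yword (Suc n)\<close> start with different letters. Hence each letter
  extends one of them to the next alternating word and, by the following facts, does not raise the
  length of the other.
\<close>

lemma first_letter_times_word:
  "(if even n then x else y) \<otimes> xword (Suc n) \<in> filt (Suc n)"
  "(if even n then y else x) \<otimes> yword (Suc n) \<in> filt (Suc n)"
proof -
  show "(if even n then x else y) \<otimes> xword (Suc n) \<in> filt (Suc n)"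
    unfolding alt_word.simps(2)
    by (rule letter_times_prefixed)
       (use alt_word_filt(1)[of n] alt_word_filt(1)[of "Suc n"] in \<open>auto simp: alt_word.simps(2)\<close>)
  show "(if even n then y else x) \<otimes> yword (Suc n) \<in> filt (Suc n)"
    unfolding alt_word.simps(2)
    by (rule letter_times_prefixed)
       (use alt_word_filt(2)[of n] alt_word_filt(2)[of "Suc n"] in \<open>auto simp: alt_word.simps(2)\<close>)
qed

lemma letter_times_word:
  assumes z: "z \<in> {x, y}"
  shows "z \<otimes> xword n \<in> filt (Suc n)" "z \<otimes> yword n \<in> filt (Suc n)"
proof -
  have 0: "z \<otimes> \<one> \<in> filt (Suc 0)"
    using z alt_word_filt[of "Suc 0"] by (auto simp: alt_word.simps(2))
  show "z \<otimes> xword n \<in> filt (Suc n)"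
  proof (cases n)
    case (Suc m)
    then consider "z = (if even m then x else y)" | "xword (Suc n) = z \<otimes> xword n"
      using z by (cases "even m") (auto simp: alt_word.simps(2)[of _ _ _ "Suc m"])
    then show ?thesis
      using first_letter_times_word(1)[of m] alt_word_filt(1)[of "Suc n"] Suc
      by cases (auto intro: filt_Suc)
  qed (use 0 in simp)
  show "z \<otimes> yword n \<in> filt (Suc n)"
  proof (cases n)
    case (Suc m)
    then consider "z = (if even m then y else x)" | "yword (Suc n) = z \<otimes> yword n"
      using z by (cases "even m") (auto simp: alt_word.simps(2)[of _ _ _ "Suc m"])
    then show ?thesis
      using first_letter_times_word(2)[of m] alt_word_filt(2)[of "Suc n"] Suc
      by cases (auto intro: filt_Suc)
  qed (use 0 in simp)
qed

lemma letter_times_smult: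
  assumes z: "z \<in> {x, y}" and k: "k \<in> K" and v: "v \<in> filt n" "z \<otimes> v \<in> filt n"
  shows "z \<otimes> (k \<otimes> v) \<in> filt n"
proof -
  obtain k' k'' where k': "k' \<in> K" "k'' \<in> K" "z \<otimes> k = k' \<otimes> z \<oplus> k''"
    using z k by (rule letter_commute)
  have "z \<otimes> (k \<otimes> v) = (z \<otimes> k) \<otimes> v"
    using letter_carrier[OF z] filt_carrier[OF v(1)] k by (simp add: m_assoc)
  also have "\<dots> = k' \<otimes> (z \<otimes> v) \<oplus> k'' \<otimes> v"
    using letter_carrier[OF z] filt_carrier[OF v(1)] k' by (simp add: m_assoc l_distr)
  also have "\<dots> \<in> filt n"
    by (rule filt_add[OF filt_smult[OF k'(1) v(2)] filt_smult[OF k'(2) v(1)]])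
  finally show ?thesis .
qed

lemma letter_times_filt:
  assumes z: "z \<in> {x, y}"
  shows "v \<in> filt n \<Longrightarrow> z \<otimes> v \<in> filt (Suc n)"
proof (induction n arbitrary: v)
  case 0
  then have "z \<otimes> (v \<otimes> \<one>) \<in> filt (Suc 0)"
    using z letter_times_word(1)[OF z, of 0]
    by (intro letter_times_smult) (auto intro: filt_Suc)
  then show ?case using 0 by simp
next
  case (Suc n)
  obtain k l w where v: "k \<in> K" "l \<in> K" "w \<in> filt n" "v = k \<otimes> xword (Suc n) \<oplus> l \<otimes> yword (Suc n) \<oplus> w"
    using Suc.prems by (rule filt_SucE)
  have "z \<otimes> v = z \<otimes> (k \<otimes> xword (Suc n)) \<oplus> z \<otimes> (l \<otimes> yword (Suc n)) \<oplus> z \<otimes> w"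
    using v letter_carrier[OF z] by (simp add: filt_carrier r_distr)
  also have "\<dots> \<in> filt (Suc (Suc n))"
    by (rule filt_add[OF filt_add[OF
          letter_times_smult[OF z v(1) filt_Suc[OF alt_word_filt(1)] letter_times_word(1)[OF z]]
          letter_times_smult[OF z v(2) filt_Suc[OF alt_word_filt(2)] letter_times_word(2)[OF z]]]
        filt_Suc[OF Suc.IH[OF v(3)]]])
  finally show ?case .
qed

text \<open>
  The elements that map the union of the spans into itself by left multiplication form a subring.
  It contains the generators, and the union of the spans contains \<open>\<one>\<close>.
\<close>

lemma carrier_filt:
  assumes "u \<in> carrier Q"
  obtains n where "u \<in> filt n"
proof -
  have "u \<in> generate_ring Q (K \<union> {x, y})" using assms generated by blast
  then have "u \<in> carrier Q \<and> (\<forall>n. \<forall>v \<in> filt n. \<exists>m. u \<otimes> v \<in> filt m)"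
  proof induction
    case one
    then show ?case by (auto simp: filt_carrier)
  next
    case (incl h)
    then consider "h \<in> K" | "h \<in> {x, y}" by blast
    then show ?case
      by cases (use filt_smult letter_times_filt letter_carrier K_carrier in blast)+
  next
    case (a_inv h)
    have "\<ominus> h \<otimes> v = \<ominus> (h \<otimes> v)" if "v \<in> filt n" for v n
      using a_inv that filt_carrier l_minus by blast
    then show ?case using a_inv filt_neg a_inv_closed by metis
  next
    case (eng_add h1 h2)
    have "\<exists>m. (h1 \<oplus> h2) \<otimes> v \<in> filt m" if v: "v \<in> filt n" for v n
    proof -
      obtain m1 m2 where "h1 \<otimes> v \<in> filt m1" "h2 \<otimes> v \<in> filt m2" using eng_add v by blast
      then have "h1 \<otimes> v \<oplus> h2 \<otimes> v \<in> filt (max m1 m2)"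
        by (intro filt_add) (auto intro: filt_mono[rotated])
      then show ?thesis using eng_add v filt_carrier by (auto simp: l_distr)
    qed
    then show ?case using eng_add by auto
  next
    case (eng_mult h1 h2)
    have "\<exists>m. (h1 \<otimes> h2) \<otimes> v \<in> filt m" if v: "v \<in> filt n" for v n
    proof -
      obtain m where "h2 \<otimes> v \<in> filt m" using eng_mult v by blast
      then have "\<exists>m. h1 \<otimes> (h2 \<otimes> v) \<in> filt m" using eng_mult by blast
      then show ?thesis using eng_mult v filt_carrier by (auto simp: m_assoc)
    qed
    then show ?case using eng_mult by auto
  qed
  moreover have "\<one> \<in> filt 0" by simp
  ultimately obtain m where "u \<otimes> \<one> \<in> filt m" by blast
  then show thesis using assms that by auto
qed

text \<open>
  The pairs of leading coefficients, in length \<open>Suc n\<close>, of all expressions of elements of \<open>J\<close>. The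
  two words of length \<open>0\<close> coincide, so that length is excluded and the constants in \<open>J\<close> are treated
  separately.
\<close>

definition lead :: "'a set \<Rightarrow> nat \<Rightarrow> ('a \<times> 'a) set"
  where "lead J n = {(k, l). k \<in> K \<and> l \<in> K \<and>
    (\<exists>w \<in> filt n. k \<otimes> xword (Suc n) \<oplus> l \<otimes> yword (Suc n) \<oplus> w \<in> J)}"

lemma lead_trivial:
  assumes "\<one> = \<zero>" shows "lead J n \<subseteq> {(\<zero>, \<zero>)}"
proof -
  have "k = \<zero>" if "k \<in> K" for k
    using r_one[of k] r_null[of k] that assms by simp
  then show ?thesis by (auto simp: lead_def)
qed

lemma lead_mono: "I \<subseteq> J \<Longrightarrow> lead I n \<subseteq> lead J n"
  by (auto simp: lead_def)

context
  fixes J assumes J: "left_ideal J Q"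
begin

interpretation J: left_ideal J Q by (rule J)

lemma lead_zero: "(\<zero>, \<zero>) \<in> lead J n"
proof -
  have "\<zero> \<otimes> xword (Suc n) \<oplus> \<zero> \<otimes> yword (Suc n) \<oplus> \<zero> \<in> J" using J.zero_closed by simp
  then show ?thesis unfolding lead_def using filt_zero K_closed(1) by blast
qed

lemma lead_add:
  assumes "(k, l) \<in> lead J n" "(k', l') \<in> lead J n"
  shows "(k \<oplus> k', l \<oplus> l') \<in> lead J n"
proof -
  obtain w w' where w: "k \<in> K" "l \<in> K" "k' \<in> K" "l' \<in> K" "w \<in> filt n" "w' \<in> filt n"
      "k \<otimes> xword (Suc n) \<oplus> l \<otimes> yword (Suc n) \<oplus> w \<in> J" "k' \<otimes> xword (Suc n) \<oplus> l' \<otimes> yword (Suc n) \<oplus> w' \<in> J"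
    using assms by (auto simp: lead_def)
  have "(k \<otimes> xword (Suc n) \<oplus> l \<otimes> yword (Suc n) \<oplus> w) \<oplus>
      (k' \<otimes> xword (Suc n) \<oplus> l' \<otimes> yword (Suc n) \<oplus> w') \<in> J"
    using w(7,8) by (rule J.a_closed)
  also have "(k \<otimes> xword (Suc n) \<oplus> l \<otimes> yword (Suc n) \<oplus> w) \<oplus> (k' \<otimes> xword (Suc n) \<oplus> l' \<otimes> yword (Suc n) \<oplus> w') =
      (k \<oplus> k') \<otimes> xword (Suc n) \<oplus> (l \<oplus> l') \<otimes> yword (Suc n) \<oplus> (w \<oplus> w')"
    using w by (simp add: filt_carrier l_distr a_ac)
  finally show ?thesis using w filt_add by (auto simp: lead_def)
qed

lemma lead_smult:
  assumes "m \<in> K" "(k, l) \<in> lead J n"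
  shows "(m \<otimes> k, m \<otimes> l) \<in> lead J n"
proof -
  obtain w where w: "k \<in> K" "l \<in> K" "w \<in> filt n" "k \<otimes> xword (Suc n) \<oplus> l \<otimes> yword (Suc n) \<oplus> w \<in> J"
    using assms by (auto simp: lead_def)
  then have "m \<otimes> (k \<otimes> xword (Suc n) \<oplus> l \<otimes> yword (Suc n) \<oplus> w) \<in> J"
    using assms by (intro J.l_closed) auto
  also have "m \<otimes> (k \<otimes> xword (Suc n) \<oplus> l \<otimes> yword (Suc n) \<oplus> w) =
      (m \<otimes> k) \<otimes> xword (Suc n) \<oplus> (m \<otimes> l) \<otimes> yword (Suc n) \<oplus> m \<otimes> w"
    using w assms by (simp add: filt_carrier r_distr m_assoc)
  finally show ?thesis using w assms filt_smult by (auto simp: lead_def)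
qed

lemma lead_scale:
  assumes "(k, l) \<in> lead J n" "k \<noteq> \<zero>"
  obtains l' where "(\<one>, l') \<in> lead J n"
proof -
  have "k \<in> K" using assms by (auto simp: lead_def)
  then obtain k' where "k' \<in> K" "k' \<otimes> k = \<one>" using K_inv assms by blast
  then show thesis using lead_smult[of k' k l n] assms that by auto
qed

text \<open>
  From an element with leading pair \<open>(k, l)\<close>, the letter that extends \<open>xword (Suc n)\<close> produces an
  element whose leading term is a multiple of \<open>xword (Suc (Suc n))\<close> alone, because it leaves the
  other word within length \<open>Suc n\<close>; the other letter isolates \<open>yword (Suc (Suc n))\<close>.
\<close>

lemma lead_Suc:
  assumes "(k, l) \<in> lead J n"
  obtains k' l' where "(k', \<zero>) \<in> lead J (Suc n)" "k \<noteq> \<zero> \<Longrightarrow> k' \<noteq> \<zero>"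
    and "(\<zero>, l') \<in> lead J (Suc n)" "l \<noteq> \<zero> \<Longrightarrow> l' \<noteq> \<zero>"
proof -
  obtain w where w: "k \<in> K" "l \<in> K" "w \<in> filt n"
    and J: "k \<otimes> xword (Suc n) \<oplus> l \<otimes> yword (Suc n) \<oplus> w \<in> J"
    using assms by (auto simp: lead_def)
  let ?u = "k \<otimes> xword (Suc n) \<oplus> l \<otimes> yword (Suc n) \<oplus> w"
  \<comment> \<open>\<open>?z\<close> is the letter that is not in front of \<open>xword (Suc n)\<close>, and \<open>?z'\<close> the one that is.\<close>
  let ?z = "if even n then y else x" and ?z' = "if even n then x else y"
  have z: "?z \<in> {x, y}" "?z' \<in> {x, y}" by auto
  note zc [simp] = letter_carrier[OF z(1)] letter_carrier[OF z(2)]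
  obtain k' k'' where k': "k' \<in> K" "k'' \<in> K" "?z \<otimes> k = k' \<otimes> ?z \<oplus> k''" "k \<noteq> \<zero> \<Longrightarrow> k' \<noteq> \<zero>"
    using letter_commute[OF z(1) w(1)] by blast
  obtain l' l'' where l': "l' \<in> K" "l'' \<in> K" "?z' \<otimes> l = l' \<otimes> ?z' \<oplus> l''" "l \<noteq> \<zero> \<Longrightarrow> l' \<noteq> \<zero>"
    using letter_commute[OF z(2) w(2)] by blast
  have xword: "xword (Suc (Suc n)) = ?z \<otimes> xword (Suc n)" and yword: "yword (Suc (Suc n)) = ?z' \<otimes> yword (Suc n)"
    by (simp_all add: alt_word.simps(2)[of _ _ _ "Suc n"])
  note wc = filt_carrier[OF w(3)]
  let ?r = "k'' \<otimes> xword (Suc n) \<oplus> ?z \<otimes> (l \<otimes> yword (Suc n)) \<oplus> ?z \<otimes> w"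
  let ?r' = "l'' \<otimes> yword (Suc n) \<oplus> ?z' \<otimes> (k \<otimes> xword (Suc n)) \<oplus> ?z' \<otimes> w"
  have r: "?r \<in> filt (Suc n)"
    by (rule filt_add[OF filt_add[OF filt_smult[OF k'(2) alt_word_filt(1)]
          letter_times_smult[OF z(1) w(2) alt_word_filt(2) first_letter_times_word(2)]]
        letter_times_filt[OF z(1) w(3)]])
  have r': "?r' \<in> filt (Suc n)"
    by (rule filt_add[OF filt_add[OF filt_smult[OF l'(2) alt_word_filt(2)]
          letter_times_smult[OF z(2) w(1) alt_word_filt(1) first_letter_times_word(1)]]
        letter_times_filt[OF z(2) w(3)]])
  have "?z \<otimes> ?u = (?z \<otimes> k) \<otimes> xword (Suc n) \<oplus> ?z \<otimes> (l \<otimes> yword (Suc n)) \<oplus> ?z \<otimes> w"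
    using w wc zc by (simp add: r_distr m_assoc del: if_split)
  also have "\<dots> = k' \<otimes> xword (Suc (Suc n)) \<oplus> \<zero> \<otimes> yword (Suc (Suc n)) \<oplus> ?r"
    unfolding k'(3) xword using w wc zc k'(1,2) by (simp add: l_distr m_assoc a_ac)
  finally have 1: "(k', \<zero>) \<in> lead J (Suc n)"
    using r k' J.l_closed[OF zc(1) J] by (auto simp: lead_def)
  have "?z' \<otimes> ?u = (?z' \<otimes> l) \<otimes> yword (Suc n) \<oplus> ?z' \<otimes> (k \<otimes> xword (Suc n)) \<oplus> ?z' \<otimes> w"
    using w wc zc by (simp add: r_distr m_assoc a_ac)
  also have "\<dots> = \<zero> \<otimes> xword (Suc (Suc n)) \<oplus> l' \<otimes> yword (Suc (Suc n)) \<oplus> ?r'"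
    unfolding l'(3) yword using w wc zc l'(1,2) by (simp add: l_distr m_assoc a_ac)
  finally have 2: "(\<zero>, l') \<in> lead J (Suc n)"
    using r' l' J.l_closed[OF zc(2) J] by (auto simp: lead_def)
  show thesis using that[OF 1 _ 2] k' l' by blast
qed

lemma lead_nonzero_mono:
  assumes "n \<le> m" "\<not> lead J n \<subseteq> {(\<zero>, \<zero>)}"
  shows "\<not> lead J m \<subseteq> {(\<zero>, \<zero>)}"
  using assms
proof (induction rule: dec_induct)
  case (step m)
  then obtain k l where "(k, l) \<in> lead J m" "k \<noteq> \<zero> \<or> l \<noteq> \<zero>" by auto
  from lead_Suc[OF this(1)] this(2) show ?case by blast
qed

lemma lead_fullI:
  assumes "(k, \<zero>) \<in> lead J n" "k \<noteq> \<zero>" "(\<zero>, l) \<in> lead J n" "l \<noteq> \<zero>"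
  shows "lead J n = K \<times> K"
proof -
  have kl: "k \<in> K" "l \<in> K" using assms by (auto simp: lead_def)
  then obtain k' l' where i: "k' \<in> K" "k' \<otimes> k = \<one>" "l' \<in> K" "l' \<otimes> l = \<one>"
    using K_inv assms by meson
  have "(p, q) \<in> lead J n" if "p \<in> K" "q \<in> K" for p q
  proof -
    have "((p \<otimes> k') \<otimes> k \<oplus> (q \<otimes> l') \<otimes> \<zero>, (p \<otimes> k') \<otimes> \<zero> \<oplus> (q \<otimes> l') \<otimes> l) \<in> lead J n"
      using assms i that by (intro lead_add lead_smult) auto
    then show ?thesis using that i kl by (simp add: m_assoc)
  qed
  then show ?thesis by (auto simp: lead_def)
qed

lemma lead_full_mono:
  assumes "n \<le> m" "lead J n = K \<times> K" and nontriv: "\<one> \<noteq> \<zero>"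
  shows "lead J m = K \<times> K"
  using assms(1,2)
proof (induction rule: dec_induct)
  case (step m)
  then have "(\<one>, \<one>) \<in> lead J m" by simp
  from lead_Suc[OF this] nontriv show ?case by (metis lead_fullI)
qed

text \<open>
  An element of \<open>J\<close> can be lowered in length by subtracting an element of \<open>I\<close> with the same leading
  pair; the difference is again in \<open>J\<close>. The descent ends in \<open>J \<inter> K\<close>.
\<close>

lemma left_ideal_subset_by_lead:
  assumes I: "left_ideal I Q" "I \<subseteq> J" and K: "J \<inter> K \<subseteq> I" and lead: "\<And>n. lead J n \<subseteq> lead I n"
  shows "J \<subseteq> I"
proof -
  interpret I: left_ideal I Q by (rule I)
  have "v \<in> I" if "v \<in> J" "v \<in> filt n" for v n
    using that
  proof (induction n arbitrary: v)
    case 0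
    then show ?case using K by auto
  next
    case (Suc n)
    obtain k l w where v: "k \<in> K" "l \<in> K" "w \<in> filt n" "v = k \<otimes> xword (Suc n) \<oplus> l \<otimes> yword (Suc n) \<oplus> w"
      using Suc.prems(2) by (rule filt_SucE)
    then have "(k, l) \<in> lead J n" using Suc.prems(1) by (auto simp: lead_def)
    then have "(k, l) \<in> lead I n" using lead by blast
    then obtain w' where w': "w' \<in> filt n" "k \<otimes> xword (Suc n) \<oplus> l \<otimes> yword (Suc n) \<oplus> w' \<in> I" (is "?v' \<in> I")
      by (auto simp: lead_def)
    have v': "?v' \<in> carrier Q" using w' v filt_carrier by simp
    have diff: "v \<ominus> ?v' = w \<ominus> w'"
    proof -
      define e where "e = k \<otimes> xword (Suc n) \<oplus> l \<otimes> yword (Suc n)"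
      have c: "e \<in> carrier Q" "w \<in> carrier Q" "w' \<in> carrier Q"
        using v w'(1) filt_carrier by (simp_all add: e_def)
      then have "(e \<oplus> w) \<ominus> (e \<oplus> w') = (e \<oplus> \<ominus> e) \<oplus> (w \<ominus> w')"
        by (simp add: minus_eq minus_add a_ac)
      then have "(e \<oplus> w) \<ominus> (e \<oplus> w') = w \<ominus> w'"
        using c by (simp add: r_neg)
      then show ?thesis unfolding v(4) e_def .
    qed
    have "v \<ominus> ?v' \<in> J"
      unfolding minus_eq
      by (rule J.a_closed[OF Suc.prems(1) J.a_inv_closed[OF subsetD[OF I(2) w'(2)]]])
    moreover have "w \<ominus> w' \<in> filt n"
      using v w' unfolding minus_eq by (intro filt_add filt_neg)
    ultimately have "v \<ominus> ?v' \<in> I" using Suc.IH diff by simp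
    then have "(v \<ominus> ?v') \<oplus> ?v' \<in> I" using w'(2) by (rule I.a_closed)
    moreover have "(v \<ominus> ?v') \<oplus> ?v' = v"
      using v' J.a_Hcarr[OF Suc.prems(1)] by (simp add: minus_eq a_assoc l_neg)
    ultimately show ?case by simp
  qed
  moreover have "\<exists>n. v \<in> filt n" if "v \<in> J" for v
    using carrier_filt[OF J.a_Hcarr[OF that]] by metis
  ultimately show ?thesis by blast
qed

end

text \<open>
  This is the place where the dimension of \<open>K\<^sup>2\<close> enters: a subspace strictly larger than a nonzero
  subspace is everything. The proof is a Gaussian elimination with one pivot.
\<close>

lemma lead_full_if_larger:
  assumes I: "left_ideal I Q" and J: "left_ideal J Q" and IJ: "I \<subseteq> J"
    and nz: "\<not> lead I n \<subseteq> {(\<zero>, \<zero>)}" and larger: "\<not> lead J n \<subseteq> lead I n"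
  shows "lead J n = K \<times> K"
proof -
  note mono = subsetD[OF lead_mono[OF IJ]]
  have nontriv: "\<one> \<noteq> \<zero>"
    using nz lead_trivial by blast
  obtain p q where pq: "(p, q) \<in> lead J n" "(p, q) \<notin> lead I n" using larger by auto
  then have pqK: "p \<in> K" "q \<in> K" by (auto simp: lead_def)
  obtain k l where kl: "(k, l) \<in> lead I n" "k \<noteq> \<zero> \<or> l \<noteq> \<zero>" using nz by auto
  show ?thesis
  proof (cases "k = \<zero>")
    case False
    then obtain m where m: "(\<one>, m) \<in> lead I n" using lead_scale[OF I] kl by blast
    then have mK: "m \<in> K" by (auto simp: lead_def)
    let ?e = "q \<oplus> \<ominus> p \<otimes> m"
    have "(p \<oplus> \<ominus> p \<otimes> \<one>, ?e) \<in> lead J n"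
      using lead_add[OF J pq(1) lead_smult[OF J _ mono[OF m]]] pqK by simp
    then have e: "(\<zero>, ?e) \<in> lead J n" using pqK by (simp add: r_neg)
    have ne: "?e \<noteq> \<zero>"
    proof
      assume "?e = \<zero>"
      then have "\<ominus> (\<ominus> p \<otimes> m) = q" using pqK mK by (intro minus_equality) auto
      then have "q = p \<otimes> m" using pqK mK by (simp add: l_minus)
      then show False using lead_smult[OF I pqK(1) m] pq(2) pqK by simp
    qed
    have eK: "?e \<in> K" using pqK mK by simp
    obtain e' where e': "e' \<in> K" "e' \<otimes> ?e = \<one>" using K_inv[OF eK ne] by blast
    have "(\<one> \<oplus> (\<ominus> m \<otimes> e') \<otimes> \<zero>, m \<oplus> (\<ominus> m \<otimes> e') \<otimes> ?e) \<in> lead J n"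
      by (rule lead_add[OF J mono[OF m] lead_smult[OF J _ e]]) (use e'(1) mK in simp)
    moreover have "m \<oplus> (\<ominus> m \<otimes> e') \<otimes> ?e = \<zero>"
    proof -
      have "(\<ominus> m \<otimes> e') \<otimes> ?e = \<ominus> m \<otimes> (e' \<otimes> ?e)"
        by (rule m_assoc) (use e'(1) eK mK in auto)
      then show ?thesis using e' mK by (simp add: r_neg)
    qed
    ultimately have "(\<one>, \<zero>) \<in> lead J n" using e'(1) mK by simp
    then show ?thesis using nontriv e ne by (rule lead_fullI[OF J])
  next
    case True
    then have l: "(\<zero>, l) \<in> lead I n" "l \<noteq> \<zero>" using kl by auto
    then have lK: "l \<in> K" by (auto simp: lead_def)
    then obtain l' where l': "l' \<in> K" "l' \<otimes> l = \<one>" using K_inv l by blast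
    have multiples: "(\<zero>, r) \<in> lead I n" if "r \<in> K" for r
      using lead_smult[OF I, of "r \<otimes> l'" \<zero> l n] l l' lK that by (simp add: m_assoc)
    then have "p \<noteq> \<zero>" using pq(2) pqK by auto
    moreover have "(p \<oplus> \<zero>, q \<oplus> \<ominus> q) \<in> lead J n"
      using pqK by (intro lead_add[OF J pq(1) mono[OF multiples]]) simp
    then have "(p, \<zero>) \<in> lead J n" using pqK by (simp add: r_neg)
    ultimately show ?thesis using mono[OF l(1)] l(2) by (intro lead_fullI[OF J])
  qed
qed

theorem left_ideal_two_generated:
  assumes J: "left_ideal J Q"
  shows "\<exists>u \<in> carrier Q. \<exists>v \<in> carrier Q. J = genlideal Q {u} \<or> J = genlideal Q {u, v}"
proof -
  interpret J: left_ideal J Q by (rule J)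
  have gen: "left_ideal (genlideal Q S) Q" "genlideal Q S \<subseteq> J" "S \<subseteq> genlideal Q S"
    if "S \<subseteq> J" for S
    by (rule genlideal_left_ideal genlideal_least[OF J that] genlideal_incl
        subset_trans[OF that J.a_subset])+
  show ?thesis
  proof (cases "J \<inter> K \<subseteq> {\<zero>}")
    case False
    then obtain k where k: "k \<in> J" "k \<in> K" "k \<noteq> \<zero>" by auto
    then obtain k' where "k' \<in> K" "k' \<otimes> k = \<one>" using K_inv by blast
    then have "\<one> \<in> J" using k J.l_closed[of k' k] by simp
    then have G: "left_ideal (genlideal Q {\<one>}) Q" "genlideal Q {\<one>} \<subseteq> J" "\<one> \<in> genlideal Q {\<one>}"
      using gen[of "{\<one>}"] by auto
    then have "u \<in> genlideal Q {\<one>}" if "u \<in> carrier Q" for u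
      using left_ideal.l_closed[OF G(1) that G(3)] that by simp
    then have "J = genlideal Q {\<one>}" using G(2) J.a_Hcarr by blast
    then show ?thesis by blast
  next
    case True
    then have JK: "J \<inter> K \<subseteq> I" if "left_ideal I Q" for I
      using additive_subgroup.zero_closed[of I Q] that by (auto simp: left_ideal_def)
    show ?thesis
    proof (cases "\<forall>n. lead J n \<subseteq> {(\<zero>, \<zero>)}")
      case True
      note G = gen[of "{\<zero>}", simplified]
      have "J \<subseteq> genlideal Q {\<zero>}"
        by (rule left_ideal_subset_by_lead[OF J G(1,2) JK[OF G(1)]])
           (use True lead_zero[OF G(1)] in blast)
      then show ?thesis using G(2) by blast
    next
      case False
      define N where "N = (LEAST n. \<not> lead J n \<subseteq> {(\<zero>, \<zero>)})"
      have N: "\<not> lead J N \<subseteq> {(\<zero>, \<zero>)}" and below: "\<And>n. n < N \<Longrightarrow> lead J n \<subseteq> {(\<zero>, \<zero>)}"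
        using LeastI_ex[of "\<lambda>n. \<not> lead J n \<subseteq> {(\<zero>, \<zero>)}"] False not_less_Least
        unfolding N_def by blast+
      have nontriv: "\<one> \<noteq> \<zero>" using N lead_trivial by blast
      obtain k l w where u: "k \<in> K" "l \<in> K" "w \<in> filt N" "k \<noteq> \<zero> \<or> l \<noteq> \<zero>"
          "k \<otimes> xword (Suc N) \<oplus> l \<otimes> yword (Suc N) \<oplus> w \<in> J" (is "?u \<in> J")
        using N by (auto simp: lead_def)
      let ?I = "genlideal Q {?u}"
      have I: "left_ideal ?I Q" "?I \<subseteq> J" "?u \<in> ?I" using gen[of "{?u}"] u(5) by auto
      have "(k, l) \<in> lead ?I N" using u I(3) by (auto simp: lead_def)
      then have "\<not> lead ?I N \<subseteq> {(\<zero>, \<zero>)}" using u(4) by auto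
      then have I_nz: "\<not> lead ?I n \<subseteq> {(\<zero>, \<zero>)}" if "N \<le> n" for n
        using lead_nonzero_mono[OF I(1) that] by blast
      show ?thesis
      proof (cases "\<forall>n. lead J n \<subseteq> lead ?I n")
        case True
        have "J \<subseteq> ?I"
          by (rule left_ideal_subset_by_lead[OF J I(1,2) JK[OF I(1)]]) (use True in blast)
        then show ?thesis using I(2) u(5) J.a_Hcarr by blast
      next
        case False
        define M where "M = (LEAST n. \<not> lead J n \<subseteq> lead ?I n)"
        have M: "\<not> lead J M \<subseteq> lead ?I M" and belowM: "\<And>n. n < M \<Longrightarrow> lead J n \<subseteq> lead ?I n"
          using LeastI_ex[of "\<lambda>n. \<not> lead J n \<subseteq> lead ?I n"] False not_less_Least
          unfolding M_def by blast+
        \<comment> \<open>Below \<open>N\<close> both spaces of leading pairs are zero, so they cannot differ there.\<close>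
        have NM: "N \<le> M"
          using M below[of M] lead_zero[OF I(1), of M]
          by (meson empty_subsetI insert_subset not_le subset_trans)
        obtain p q w' where v: "p \<in> K" "q \<in> K" "w' \<in> filt M" "(p, q) \<notin> lead ?I M"
            "p \<otimes> xword (Suc M) \<oplus> q \<otimes> yword (Suc M) \<oplus> w' \<in> J" (is "?v \<in> J")
          using M by (force simp: lead_def)
        let ?G = "genlideal Q {?u, ?v}"
        have G: "left_ideal ?G Q" "?G \<subseteq> J" "?u \<in> ?G" "?v \<in> ?G"
          using gen[of "{?u, ?v}"] u(5) v(5) by auto
        have IG: "?I \<subseteq> ?G" using genlideal_least[OF G(1), of "{?u}"] G(3) by auto
        have "(p, q) \<in> lead ?G M" using v G(4) by (auto simp: lead_def)
        then have "lead ?G M = K \<times> K"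
          using v(4) by (intro lead_full_if_larger[OF I(1) G(1) IG I_nz[OF NM]]) auto
        then have "lead ?G n = K \<times> K" if "M \<le> n" for n
          using lead_full_mono[OF G(1) that _ nontriv] by blast
        then have "lead J n \<subseteq> lead ?G n" for n
          using belowM[of n] lead_mono[OF IG, of n] by (cases "n < M") (auto simp: lead_def)
        then have "J \<subseteq> ?G"
          by (rule left_ideal_subset_by_lead[OF J G(1,2) JK[OF G(1)]])
        then show ?thesis using G(2) u(5) v(5) J.a_Hcarr by blast
      qed
    qed
  qed
qed

end


section \<open>The amalgamated product is generated by two quadratic elements\<close>

lemma (in skew_field) nonzero_inverse:
  assumes "r \<in> carrier R" "r \<noteq> \<zero>"
  obtains s where "s \<in> carrier R" "s \<otimes> r = \<one>" "r \<otimes> s = \<one>"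
proof -
  have "r \<in> Units R" using assms units_nonzero by simp
  then show thesis using that[of "inv r"] by simp
qed

lemma (in skew_field) hom_nonzero:
  assumes S: "ring S" and h: "h \<in> ring_hom R S" and "\<one>\<^bsub>S\<^esub> \<noteq> \<zero>\<^bsub>S\<^esub>"
    and r: "r \<in> carrier R" "r \<noteq> \<zero>"
  shows "h r \<noteq> \<zero>\<^bsub>S\<^esub>"
proof
  interpret S: ring S by (rule S)
  assume 0: "h r = \<zero>\<^bsub>S\<^esub>"
  obtain s where s: "s \<in> carrier R" "s \<otimes> r = \<one>" using nonzero_inverse[OF r] by blast
  have "\<one>\<^bsub>S\<^esub> = h s \<otimes>\<^bsub>S\<^esub> h r"
    using ring_hom_mult[OF h s(1) r(1)] ring_hom_one[OF h] s by simp
  then show False using 0 assms(3) ring_hom_closed[OF h s(1)] by simp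
qed

lemma (in skew_field) hom_image_subring:
  assumes "ring S" "h \<in> ring_hom R S"
  shows "subring (h ` carrier R) S"
proof -
  interpret h: ring_hom_ring R S h
    using assms ring_axioms by (simp add: ring_hom_ring.intro ring_hom_ring_axioms.intro)
  show ?thesis using h.img_is_subring[OF ring.carrier_is_subring[OF ring_axioms]] .
qed

lemma (in skew_field) hom_image_inverse:
  assumes S: "ring S" and h: "h \<in> ring_hom R S" and k: "k \<in> h ` carrier R" "k \<noteq> \<zero>\<^bsub>S\<^esub>"
  shows "\<exists>k' \<in> h ` carrier R. k' \<otimes>\<^bsub>S\<^esub> k = \<one>\<^bsub>S\<^esub> \<and> k \<otimes>\<^bsub>S\<^esub> k' = \<one>\<^bsub>S\<^esub>"
proof -
  obtain r where r: "r \<in> carrier R" "k = h r" using k by blast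
  then have "r \<noteq> \<zero>" using k ring_hom_zero[OF h ring_axioms S] by auto
  with r(1) obtain s where s: "s \<in> carrier R" "s \<otimes> r = \<one>" "r \<otimes> s = \<one>" by (rule nonzero_inverse)
  then have "h s \<otimes>\<^bsub>S\<^esub> k = \<one>\<^bsub>S\<^esub> \<and> k \<otimes>\<^bsub>S\<^esub> h s = \<one>\<^bsub>S\<^esub>"
    using ring_hom_mult[OF h s(1) r(1)] ring_hom_mult[OF h r(1) s(1)] ring_hom_one[OF h] r by simp
  then show ?thesis using s by blast
qed

context
  fixes R :: "('r, 'l) ring_scheme" and A :: "('a, 'm) ring_scheme" and S :: "('s, 'n) ring_scheme"
    and i x \<tau> \<delta> a b f
  assumes skew: "skew_field R" and data: "quadratic_data R A i x \<tau> \<delta> a b"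
    and S: "ring S" and f: "f \<in> ring_hom A S"
begin

interpretation R: skew_field R by (rule skew)
interpretation S: ring S by (rule S)
interpretation A: ring A using data by (simp add: quadratic_data_def quadratic_extension_def)

private abbreviation "j \<equiv> f \<circ> i"

lemma quadratic_data_facts:
  "x \<in> carrier A" "i \<in> ring_hom R A" "\<tau> \<in> ring_hom R R" "\<delta> \<in> carrier R \<rightarrow> carrier R"
  "a \<in> carrier R" "b \<in> carrier R"
  "r \<in> carrier R \<Longrightarrow> x \<otimes>\<^bsub>A\<^esub> i r = i (\<tau> r) \<otimes>\<^bsub>A\<^esub> x \<oplus>\<^bsub>A\<^esub> i (\<delta> r)"
  "x \<otimes>\<^bsub>A\<^esub> x = i a \<otimes>\<^bsub>A\<^esub> x \<oplus>\<^bsub>A\<^esub> i b"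
  using data by (auto simp: quadratic_data_def quadratic_extension_def left_derivation_def)

lemma comp_hom: "j \<in> ring_hom R S"
  using quadratic_data_facts(2) f by (rule ring_hom_trans)

lemma image_closed: "r \<in> carrier R \<Longrightarrow> f (i r) \<in> carrier S" "f x \<in> carrier S"
  using ring_hom_closed[OF comp_hom, of r] ring_hom_closed[OF f quadratic_data_facts(1)] by auto

lemma derivation_closed: "r \<in> carrier R \<Longrightarrow> \<tau> r \<in> carrier R" "r \<in> carrier R \<Longrightarrow> \<delta> r \<in> carrier R"
  using quadratic_data_facts(3,4) by (auto intro: ring_hom_closed)

lemma image_commute:
  assumes r: "r \<in> carrier R"
  shows "f x \<otimes>\<^bsub>S\<^esub> f (i r) = f (i (\<tau> r)) \<otimes>\<^bsub>S\<^esub> f x \<oplus>\<^bsub>S\<^esub> f (i (\<delta> r))"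
proof -
  have i: "\<And>s. s \<in> carrier R \<Longrightarrow> i s \<in> carrier A" using quadratic_data_facts(2) by (rule ring_hom_closed)
  have "f x \<otimes>\<^bsub>S\<^esub> f (i r) = f (x \<otimes>\<^bsub>A\<^esub> i r)"
    using ring_hom_mult[OF f quadratic_data_facts(1) i[OF r]] by simp
  then show ?thesis
    using quadratic_data_facts(1) i derivation_closed[OF r]
    by (simp add: quadratic_data_facts(7)[OF r] ring_hom_add[OF f] ring_hom_mult[OF f])
qed

lemma image_square: "f x \<otimes>\<^bsub>S\<^esub> f x = f (i a) \<otimes>\<^bsub>S\<^esub> f x \<oplus>\<^bsub>S\<^esub> f (i b)"
proof -
  have i: "\<And>s. s \<in> carrier R \<Longrightarrow> i s \<in> carrier A" using quadratic_data_facts(2) by (rule ring_hom_closed)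
  have "f x \<otimes>\<^bsub>S\<^esub> f x = f (x \<otimes>\<^bsub>A\<^esub> x)"
    using ring_hom_mult[OF f quadratic_data_facts(1,1)] by simp
  then show ?thesis
    using quadratic_data_facts(1,5,6) i
    by (simp add: quadratic_data_facts(8) ring_hom_add[OF f] ring_hom_mult[OF f])
qed

text \<open>
  One nonzero value of \<open>f \<circ> i\<close> excludes that \<open>S\<close> is the zero ring, and a homomorphism from a division
  ring to any other ring is injective.
\<close>

lemma image_nonzero:
  assumes "r \<in> carrier R" "f (i r) \<noteq> \<zero>\<^bsub>S\<^esub>" "s \<in> carrier R" "s \<noteq> \<zero>\<^bsub>R\<^esub>"
  shows "f (i s) \<noteq> \<zero>\<^bsub>S\<^esub>"
proof -
  have "\<one>\<^bsub>S\<^esub> \<noteq> \<zero>\<^bsub>S\<^esub>"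
    using assms(2) image_closed(1)[OF assms(1)] by (metis S.r_one S.r_null)
  then show ?thesis using R.hom_nonzero[OF S comp_hom _ assms(3,4)] by simp
qed

lemma image_zero: "f (i \<zero>\<^bsub>R\<^esub>) = \<zero>\<^bsub>S\<^esub>"
  using ring_hom_zero[OF comp_hom R.ring_axioms S] by simp

lemma quadratic_over_image: "quadratic_over S (j ` carrier R) (f x)"
  unfolding quadratic_over_def
proof (intro conjI ballI)
  show "f x \<in> carrier S" by (rule image_closed)
  show "\<exists>k\<in>j ` carrier R. \<exists>l\<in>j ` carrier R. f x \<otimes>\<^bsub>S\<^esub> f x = k \<otimes>\<^bsub>S\<^esub> f x \<oplus>\<^bsub>S\<^esub> l"
    using image_square quadratic_data_facts(5,6) by auto
  fix k assume "k \<in> j ` carrier R"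
  then obtain r where r: "r \<in> carrier R" "k = f (i r)" by auto
  have "f (i (\<tau> r)) \<noteq> \<zero>\<^bsub>S\<^esub>" if "k \<noteq> \<zero>\<^bsub>S\<^esub>"
  proof (rule image_nonzero[OF r(1)])
    have "r \<noteq> \<zero>\<^bsub>R\<^esub>" using that r image_zero by auto
    then show "\<tau> r \<noteq> \<zero>\<^bsub>R\<^esub>"
      using R.hom_nonzero[OF R.ring_axioms quadratic_data_facts(3) R.one_not_zero r(1)] by simp
  qed (use that r derivation_closed in auto)
  then show "\<exists>k'\<in>j ` carrier R. \<exists>k''\<in>j ` carrier R.
      f x \<otimes>\<^bsub>S\<^esub> k = k' \<otimes>\<^bsub>S\<^esub> f x \<oplus>\<^bsub>S\<^esub> k'' \<and> (k \<noteq> \<zero>\<^bsub>S\<^esub> \<longrightarrow> k' \<noteq> \<zero>\<^bsub>S\<^esub>)"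
    using image_commute[OF r(1)] derivation_closed[OF r(1)] r(2) by auto
qed

text \<open>
  In the opposite ring the rule for moving \<open>x\<close> past a scalar \<open>r\<close> reads
  \<open>r x = x \<tau>\<inverse>(r) - \<delta>(\<tau>\<inverse>(r))\<close>, by solving \<open>x s = \<tau>(s) x + \<delta>(s)\<close> for \<open>\<tau>(s) x\<close>.
\<close>

lemma quadratic_over_opposite_image:
  assumes iso: "\<tau> \<in> ring_iso R R"
  shows "quadratic_over (opposite S) (j ` carrier R) (f x)"
proof -
  note K = subringE[OF R.hom_image_subring[OF S comp_hom]]
  have swap: "\<exists>s \<in> carrier R. \<tau> s = r \<and>
      f (i r) \<otimes>\<^bsub>S\<^esub> f x = f x \<otimes>\<^bsub>S\<^esub> f (i s) \<oplus>\<^bsub>S\<^esub> \<ominus>\<^bsub>S\<^esub> f (i (\<delta> s))" if "r \<in> carrier R" for r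
  proof -
    have "\<tau> ` carrier R = carrier R" using iso by (simp add: ring_iso_def bij_betw_def)
    then obtain s where s: "s \<in> carrier R" "\<tau> s = r" using \<open>r \<in> carrier R\<close> by (metis imageE)
    have "f x \<otimes>\<^bsub>S\<^esub> f (i s) \<oplus>\<^bsub>S\<^esub> \<ominus>\<^bsub>S\<^esub> f (i (\<delta> s)) = f (i r) \<otimes>\<^bsub>S\<^esub> f x"
      unfolding image_commute[OF s(1)]
      using image_closed that s derivation_closed[OF s(1)] by (simp add: S.a_assoc S.r_neg)
    then show ?thesis using s by metis
  qed
  have zero: "\<tau> \<zero>\<^bsub>R\<^esub> = \<zero>\<^bsub>R\<^esub>"
    by (rule ring_hom_zero[OF quadratic_data_facts(3) R.ring_axioms R.ring_axioms])
  show ?thesis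
    unfolding quadratic_over_def opposite_sel
  proof (intro conjI ballI)
    show "f x \<in> carrier S" by (rule image_closed)
    obtain s where s: "s \<in> carrier R"
        "f (i a) \<otimes>\<^bsub>S\<^esub> f x = f x \<otimes>\<^bsub>S\<^esub> f (i s) \<oplus>\<^bsub>S\<^esub> \<ominus>\<^bsub>S\<^esub> f (i (\<delta> s))"
      using swap[OF quadratic_data_facts(5)] by blast
    have "f x \<otimes>\<^bsub>S\<^esub> f x = f x \<otimes>\<^bsub>S\<^esub> f (i s) \<oplus>\<^bsub>S\<^esub> (\<ominus>\<^bsub>S\<^esub> f (i (\<delta> s)) \<oplus>\<^bsub>S\<^esub> f (i b))"
      unfolding image_square s(2)
      using image_closed s(1) derivation_closed(2)[OF s(1)] quadratic_data_facts(6)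
      by (simp add: S.a_assoc)
    moreover have "\<ominus>\<^bsub>S\<^esub> f (i (\<delta> s)) \<oplus>\<^bsub>S\<^esub> f (i b) \<in> j ` carrier R"
      using derivation_closed(2)[OF s(1)] quadratic_data_facts(6) by (intro K(5,7)) auto
    ultimately show "\<exists>k\<in>j ` carrier R. \<exists>l\<in>j ` carrier R. f x \<otimes>\<^bsub>S\<^esub> f x = f x \<otimes>\<^bsub>S\<^esub> k \<oplus>\<^bsub>S\<^esub> l"
      using s(1) by (metis comp_apply image_eqI)
    fix k assume "k \<in> j ` carrier R"
    then obtain r where r: "r \<in> carrier R" "k = f (i r)" by auto
    obtain s where s: "s \<in> carrier R" "\<tau> s = r"
        "f (i r) \<otimes>\<^bsub>S\<^esub> f x = f x \<otimes>\<^bsub>S\<^esub> f (i s) \<oplus>\<^bsub>S\<^esub> \<ominus>\<^bsub>S\<^esub> f (i (\<delta> s))"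
      using swap[OF r(1)] by blast
    have "f (i s) \<noteq> \<zero>\<^bsub>S\<^esub>" if "k \<noteq> \<zero>\<^bsub>S\<^esub>"
    proof (rule image_nonzero[OF r(1) _ s(1)])
      show "s \<noteq> \<zero>\<^bsub>R\<^esub>" using that r(2) s(2) zero image_zero by metis
    qed (use that r(2) in simp)
    moreover have "\<ominus>\<^bsub>S\<^esub> f (i (\<delta> s)) \<in> j ` carrier R"
      using derivation_closed(2)[OF s(1)] by (intro K(5)) auto
    moreover have "f (i s) \<in> j ` carrier R" using s(1) by auto
    moreover have "k \<otimes>\<^bsub>S\<^esub> f x = f x \<otimes>\<^bsub>S\<^esub> f (i s) \<oplus>\<^bsub>S\<^esub> \<ominus>\<^bsub>S\<^esub> f (i (\<delta> s))"
      using s(3) r(2) by simp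
    ultimately show "\<exists>k'\<in>j ` carrier R. \<exists>k''\<in>j ` carrier R.
        k \<otimes>\<^bsub>S\<^esub> f x = f x \<otimes>\<^bsub>S\<^esub> k' \<oplus>\<^bsub>S\<^esub> k'' \<and> (k \<noteq> \<zero>\<^bsub>S\<^esub> \<longrightarrow> k' \<noteq> \<zero>\<^bsub>S\<^esub>)"
      by blast
  qed
qed

lemma image_generated:
  assumes "u \<in> carrier A" and H: "j ` carrier R \<subseteq> H" "f x \<in> H"
  shows "f u \<in> generate_ring S H"
proof -
  have "\<exists>r s. r \<in> carrier R \<and> s \<in> carrier R \<and> u = i r \<oplus>\<^bsub>A\<^esub> i s \<otimes>\<^bsub>A\<^esub> x"
    using assms(1) data unfolding quadratic_data_def quadratic_extension_def by blast
  then obtain r s where rs: "r \<in> carrier R" "s \<in> carrier R" "u = i r \<oplus>\<^bsub>A\<^esub> i s \<otimes>\<^bsub>A\<^esub> x" by blast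
  have i: "\<And>s. s \<in> carrier R \<Longrightarrow> i s \<in> carrier A" using quadratic_data_facts(2) by (rule ring_hom_closed)
  have "f u = f (i r) \<oplus>\<^bsub>S\<^esub> f (i s) \<otimes>\<^bsub>S\<^esub> f x"
    using rs quadratic_data_facts(1) i by (simp add: ring_hom_add[OF f] ring_hom_mult[OF f])
  also have "\<dots> \<in> generate_ring S H"
    using H rs by (intro generate_ring.eng_add generate_ring.eng_mult generate_ring.incl) auto
  finally show ?thesis .
qed

end

lemma (in ring_span) amalgam_generated:
  assumes L: "\<And>u. u \<in> carrier A \<Longrightarrow> inl u \<in> generate_ring P H"
    and R: "\<And>v. v \<in> carrier B \<Longrightarrow> inr v \<in> generate_ring P H"
  shows "carrier P \<subseteq> generate_ring P H"
proof
  interpret P: ring P by (rule amalgam_ring)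
  fix C assume "C \<in> carrier P"
  then obtain p where p: "p \<in> T" "C = E `` {p}" by (rule amalgam_carrierE)
  have "E `` {p} \<in> generate_ring P H"
    using p(1)
  proof induction
    case (GenL u)
    then show ?case using L by (simp add: amalgam_inl_def)
  next
    case (GenR v)
    then show ?case using R by (simp add: amalgam_inr_def)
  next
    case Zero
    then show ?case using P.zero_in_generate by (simp add: amalgam_zero)
  next
    case One
    then show ?case using generate_ring.one by (metis amalgam_one)
  next
    case (Add p q)
    then show ?case using generate_ring.eng_add by (metis amalgam_add)
  next
    case (Neg p)
    have "E `` {Neg p} \<oplus>\<^bsub>P\<^esub> E `` {p} = \<zero>\<^bsub>P\<^esub>"
      using Neg by (simp add: amalgam_ops rexps.intros amalgam_laws)
    then have "\<ominus>\<^bsub>P\<^esub> E `` {p} = E `` {Neg p}"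
      using Neg by (intro P.minus_equality) (auto intro: amalgam_carrierI rexps.Neg)
    then show ?case using generate_ring.a_inv[OF Neg.IH] by simp
  next
    case (Mul p q)
    then show ?case using generate_ring.eng_mult by (metis amalgam_mult)
  qed
  then show "C \<in> generate_ring P H" using p by simp
qed

theorem theorem1p4:
  fixes R :: "'r ring" and Q1 :: "'a ring" and Q2 :: "'b ring" and Q :: "('a, 'b) rexp set ring"
    and i1 :: "'r \<Rightarrow> 'a" and i2 :: "'r \<Rightarrow> 'b" and x :: 'a and y :: 'b
    and \<tau>1 \<delta>1 \<tau>2 \<delta>2 :: "'r \<Rightarrow> 'r" and a b c d :: 'r
  assumes "skew_field R"
    and "quadratic_data R Q1 i1 x \<tau>1 \<delta>1 a b"
    and "quadratic_data R Q2 i2 y \<tau>2 \<delta>2 c d"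
    and "Q = amalgam R Q1 Q2 i1 i2"
    and "\<tau>1 \<in> ring_iso R R" and "\<tau>2 \<in> ring_iso R R"
  shows "(\<forall>J. left_ideal J Q \<longrightarrow>
            (\<exists>u \<in> carrier Q. J = genlideal Q {u}) \<or>
            (\<exists>u \<in> carrier Q. \<exists>v \<in> carrier Q. J = genlideal Q {u, v})) \<and>
         (\<forall>J. right_ideal J Q \<longrightarrow>
            (\<exists>u \<in> carrier Q. J = genrideal Q {u}) \<or>
            (\<exists>u \<in> carrier Q. \<exists>v \<in> carrier Q. J = genrideal Q {u, v}))"
proof -
  interpret R: skew_field R by (rule assms(1))
  interpret ring_span R Q1 Q2 i1 i2
    using assms(2,3) R.ring_axioms
    by (auto simp: quadratic_data_def quadratic_extension_def
        intro!: ring_span.intro ring_span_axioms.intro)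
  have Q: "Q = P" by (rule assms(4))
  have ring: "ring Q" unfolding Q by (rule amalgam_ring)
  have inl: "inl \<in> ring_hom Q1 Q" and inr: "inr \<in> ring_hom Q2 Q"
    unfolding Q by (rule amalgam_square)+
  let ?K = "(inl \<circ> i1) ` carrier R"
  have K: "(inr \<circ> i2) ` carrier R = ?K"
    using amalgam_square(3) by (intro image_cong) auto
  note j = comp_hom[OF assms(1,2) ring inl]
  let ?G = "?K \<union> {inl x, inr y}"
  have gen: "carrier Q \<subseteq> generate_ring Q ?G"
    unfolding Q
    by (rule amalgam_generated)
       (use image_generated[OF assms(1,2) ring inl, where H = ?G]
          image_generated[OF assms(1,3) ring inr, where H = ?G] K in \<open>auto simp: Q\<close>)
  have sub: "subring ?K Q" by (rule R.hom_image_subring[OF ring j])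
  have inv: "\<exists>k' \<in> ?K. k' \<otimes>\<^bsub>Q\<^esub> k = \<one>\<^bsub>Q\<^esub> \<and> k \<otimes>\<^bsub>Q\<^esub> k' = \<one>\<^bsub>Q\<^esub>"
    if "k \<in> ?K" "k \<noteq> \<zero>\<^bsub>Q\<^esub>" for k
    by (rule R.hom_image_inverse[OF ring j that])
  have inv_left: "\<exists>k' \<in> ?K. k' \<otimes>\<^bsub>Q\<^esub> k = \<one>\<^bsub>Q\<^esub>" if "k \<in> ?K" "k \<noteq> \<zero>\<^bsub>Q\<^esub>" for k
    using inv[OF that] by blast
  have inv_right: "\<exists>k' \<in> ?K. k \<otimes>\<^bsub>Q\<^esub> k' = \<one>\<^bsub>Q\<^esub>" if "k \<in> ?K" "k \<noteq> \<zero>\<^bsub>Q\<^esub>" for k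
    using inv[OF that] by blast
  interpret left: two_quadratic_generators Q ?K "inl x" "inr y"
    using ring sub inv_left gen quadratic_over_image[OF assms(1,2) ring inl]
      quadratic_over_image[OF assms(1,3) ring inr]
    by (intro two_quadratic_generators.intro two_quadratic_generators_axioms.intro)
       (simp_all only: K)
  have sub': "subring ?K (opposite Q)"
    using subringE[OF sub] by (intro ring.subringI ring_opposite ring) auto
  interpret right: two_quadratic_generators "opposite Q" ?K "inl x" "inr y"
    using ring_opposite[OF ring] sub' inv_right gen
      quadratic_over_opposite_image[OF assms(1,2) ring inl assms(5)]
      quadratic_over_opposite_image[OF assms(1,3) ring inr assms(6)]
    by (intro two_quadratic_generators.intro two_quadratic_generators_axioms.intro)
       (simp_all only: K opposite_sel generate_ring_opposite)
  show ?thesis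
    using left.left_ideal_two_generated
      right.left_ideal_two_generated[unfolded left_ideal_opposite genlideal_opposite opposite_sel]
    by meson
qed

end
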